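(* Under the low-edge, fixed-active-support assumptions described in the context, let $$V_{\mathrm{sing}}(\varepsilon):=\mathcal{G}^{\mathrm{sing}}_{\varepsilon}\bigl(x^{\mathrm{sim}}(\varepsilon)\bigr),\qquad V_{\mathrm{par}}(\varepsilon):=\sum_{j=1}^m\mathcal{G}^{\mathrm{ind}}_{j,\varepsilon}\bigl(x_j^{\mathrm{ind}}(\varepsilon)\bigr).$$ Then, for all sufficiently small $\varepsilon>0$, $$0\le V_{\mathrm{par}}(\varepsilon)-V_{\mathrm{sing}}(\varepsilon),\qquad\text{and}\qquad V_{\mathrm{par}}(\varepsilon)-V_{\mathrm{sing}}(\varepsilon)=O(\varepsilon^4)\quad\text{as }\varepsilon\to0.$$
   Context: There are $m\ge1$ event blocks. For each small edge parameter $\varepsilon>0$ and each $j=1,\dots,m$, $Z_j^{(\varepsilon)}$ is a random vector in $\mathbb{R}^{d_j}$ (the excess-return vector of block $j$ restricted to its active outcomes; its law may depend on $\varepsilon$), and a stake vector on block $j$ is a vector of nonnegative stakes $x_j\in\mathbb{R}^{d_j}$ on the active outcomes. Standing low-edge assumptions: (i) for each $\varepsilon$ the blocks $Z_1^{(\varepsilon)},\dots,Z_m^{(\varepsilon)}$ are independent; (ii) the $Z_j^{(\varepsilon)}$ are uniformly bounded (by a constant not depending on $\varepsilon$); (iii) as $\varepsilon\to0$, $\mathbb{E}[Z_j^{(\varepsilon)}]=a_j\varepsilon+O(\varepsilon^2)$ and $\mathbb{E}[Z_j^{(\varepsilon)}Z_j^{(\varepsilon)\top}]=C_j+O(\varepsilon)$,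 with fixed $a_j\in\mathbb{R}^{d_j}$ and fixed positive definite $C_j$; (iv) the active support is fixed for all sufficiently small $\varepsilon$: the maximizers below have all coordinates strictly positive, so that the nonnegativity constraints do not bind. Objectives (with $\log t=-\infty$ for $t\le0$): $$\mathcal{G}^{\mathrm{ind}}_{j,\varepsilon}(y):=\mathbb{E}\bigl[\log(1+y^\top Z_j^{(\varepsilon)})\bigr],\qquad \mathcal{G}^{\mathrm{sing}}_{\varepsilon}(x_1,\dots,x_m):=\mathbb{E}\Bigl[\log\Bigl(1+\sum_{j=1}^m x_j^\top Z_j^{(\varepsilon)}\Bigr)\Bigr].$$ $x_j^{\mathrm{ind}}(\varepsilon)$ denotes the maximizer of $\mathcal{G}^{\mathrm{ind}}_{j,\varepsilon}$ (isolated maximizer), and $x^{\mathrm{sim}}(\varepsilon)=(x_1^{\mathrm{sim}}(\varepsilon),\dots,x_m^{\mathrm{sim}}(\varepsilon))$ the maximizer of $\mathcal{G}^{\mathrm{sing}}_\varepsilon$ (singles-only simultaneous maximizer). $V_{\mathrm{par}}(\varepsilon)$ is the optimal growth rate when parlays are allowed, and $V_{\mathrm{sing}}(\varepsilon)$ the optimal growth rate when only singles are allowed. *)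

theory Defs
  imports "HOL-Probability.Probability" "HOL-Library.Landau_Symbols"
begin

text \<open>
  Blocks are indexed by \<open>{1..m}\<close>. The dimensions \<open>d j\<close> vary with the block, so a vector of
  \<open>\<real>\<^sup>n\<close> is a function on \<open>nat\<close> of which only the coordinates in \<open>{1..n}\<close> matter, and its
  Borel space is the product measurable space \<open>PiM {1..n} (\<lambda>_. borel)\<close>.
\<close>

definition dotp :: "nat \<Rightarrow> (nat \<Rightarrow> real) \<Rightarrow> (nat \<Rightarrow> real) \<Rightarrow> real" where
  "dotp n y z = (\<Sum>k\<in>{1..n}. y k * z k)"

definition stake_vector :: "nat \<Rightarrow> (nat \<Rightarrow> real) \<Rightarrow> bool" where
  "stake_vector n y \<longleftrightarrow> (\<forall>k\<in>{1..n}. 0 \<le> y k)"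

definition stake_profile :: "nat \<Rightarrow> (nat \<Rightarrow> nat) \<Rightarrow> (nat \<Rightarrow> nat \<Rightarrow> real) \<Rightarrow> bool" where
  "stake_profile m d x \<longleftrightarrow> (\<forall>j\<in>{1..m}. stake_vector (d j) (x j))"

definition positive_definite_mat :: "nat \<Rightarrow> (nat \<Rightarrow> nat \<Rightarrow> real) \<Rightarrow> bool" where
  "positive_definite_mat n A \<longleftrightarrow>
     (\<forall>k\<in>{1..n}. \<forall>l\<in>{1..n}. A k l = A l k) \<and>
     (\<forall>v. (\<exists>k\<in>{1..n}. v k \<noteq> 0) \<longrightarrow> 0 < (\<Sum>k\<in>{1..n}. \<Sum>l\<in>{1..n}. v k * A k l * v l))"

definition log_ext :: "real \<Rightarrow> ereal" where
  "log_ext t = (if t \<le> 0 then - \<infinity> else ereal (ln t))"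

text \<open>
  The extended expectation \<open>E[X\<^sup>+] - E[X\<^sup>-]\<close>; \<^const>\<open>e2ennreal\<close> maps negative numbers
  to 0. Below, the argument is bounded above almost surely, so the first integral is finite
  and the difference is never \<open>\<infinity> - \<infinity>\<close>.
\<close>
definition expect_ext :: "'w measure \<Rightarrow> ('w \<Rightarrow> ereal) \<Rightarrow> ereal" where
  "expect_ext M X =
     enn2ereal (\<integral>\<^sup>+ \<omega>. e2ennreal (X \<omega>) \<partial>M) - enn2ereal (\<integral>\<^sup>+ \<omega>. e2ennreal (- X \<omega>) \<partial>M)"

definition G_ind :: "nat \<Rightarrow> 'w measure \<Rightarrow> ('w \<Rightarrow> nat \<Rightarrow> real) \<Rightarrow> (nat \<Rightarrow> real) \<Rightarrow> ereal" where
  "G_ind n M Z y = expect_ext M (\<lambda>\<omega>. log_ext (1 + dotp n y (Z \<omega>)))"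

definition G_sing ::
    "nat \<Rightarrow> (nat \<Rightarrow> nat) \<Rightarrow> 'w measure \<Rightarrow> (nat \<Rightarrow> 'w \<Rightarrow> nat \<Rightarrow> real) \<Rightarrow>
      (nat \<Rightarrow> nat \<Rightarrow> real) \<Rightarrow> ereal" where
  "G_sing m d M Z x =
     expect_ext M (\<lambda>\<omega>. log_ext (1 + (\<Sum>j\<in>{1..m}. dotp (d j) (x j) (Z j \<omega>))))"

end

theory Submission
  imports Defs "HOL-Real_Asymp.Real_Asymp"
begin

text \<open>
  Fix \<open>\<epsilon>\<close>, let \<open>y\<^sub>j\<close> be the isolated maximizers, \<open>S\<^sub>j = y\<^sub>j \<bullet> Z\<^sub>j\<close>, and let
  \<open>P = \<Prod>\<^sub>j (1 + S\<^sub>j)\<close> be the wealth obtained when each isolated stake is reinvested in the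
  next block, which is what parlays achieve; then \<open>V\<^sub>p\<^sub>a\<^sub>r = E[ln P]\<close>. Both inequalities follow
  from one identity. Interior maximality makes \<open>E[Z\<^sub>j\<^sub>k / (1 + S\<^sub>j)]\<close> vanish, hence
  \<open>E[1 / (1 + S\<^sub>j)] = E[1 - S\<^sub>j / (1 + S\<^sub>j)] = 1\<close>, and independence of the blocks gives, for
  every profile \<open>x\<close> of single bets with wealth \<open>W\<^sub>x = 1 + \<Sum>\<^sub>j x\<^sub>j \<bullet> Z\<^sub>j\<close>,
  \<open>E[W\<^sub>x / P] = 1\<close> (\<open>expected_singles_over_parlay\<close>).

  For the lower bound on the gap, \<open>E[ln (W\<^sub>x / P)] \<le> E[W\<^sub>x / P - 1] = 0\<close> for every \<open>x\<close>, in
  particular for the simultaneous maximizer.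

  For the upper bound, the simultaneous maximizer does at least as well as the profile \<open>y\<close>. Put
  \<open>R = W\<^sub>y / P - 1\<close>. If all \<open>\<bar>S\<^sub>j\<bar> \<le> \<delta>\<close>, then \<open>P\<close> and \<open>W\<^sub>y\<close> agree up to products of at least two
  of the \<open>S\<^sub>j\<close>, so \<open>R = O(\<delta>\<^sup>2)\<close>. As \<open>E[R] = 0\<close>, the linear term of \<open>ln (1 + R)\<close> drops out and
  the gap is at most \<open>- E[ln (1 + R)] = O(E[R\<^sup>2]) = O(\<delta>\<^sup>4)\<close>
  (\<open>parlay_value_sandwich\<close>).

  It remains that \<open>\<delta> = O(\<epsilon>)\<close>, that is, that the isolated stakes are of first order
  (\<open>eventually_optimal_stake_size_le\<close>). This is where the moment assumptions enter: the growth rate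
  of a small stake \<open>y\<close> is at most about \<open>y \<bullet> E[Z] - y\<^sup>T C y / 4\<close>, with a drift of order \<open>\<epsilon> \<bar>y\<bar>\<close> and a
  penalty of order \<open>\<bar>y\<bar>\<^sup>2\<close>, so it can only be nonnegative if \<open>\<bar>y\<bar> = O(\<epsilon>)\<close>. Concavity of the growth
  rate, which vanishes at \<open>y = 0\<close>, excludes large stakes by scaling them down.
\<close>

section \<open>Logarithm estimates and stakes\<close>

lemma ln_one_plus_le_quadratic:
  fixes u :: real
  assumes "\<bar>u\<bar> \<le> 1/2"
  shows "ln (1 + u) \<le> u - u\<^sup>2 / 4"
proof -
  define g where "g = (\<lambda>u::real. u - u\<^sup>2 / 4 - ln (1 + u))"
  have deriv: "(g has_real_derivative (x * (1 - x) / (2 * (1 + x)))) (at x)" if "-1/2 \<le> x" for x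
    unfolding g_def using that
    by (auto intro!: derivative_eq_intros simp: field_simps power2_eq_square)
  have "g 0 \<le> g u"
  proof (cases "0 \<le> u")
    case True
    have "\<exists>y. (g has_real_derivative y) (at x) \<and> 0 \<le> y" if "0 \<le> x" "x \<le> u" for x
      using deriv[of x] that assms
      by (intro exI[of _ "x * (1 - x) / (2 * (1 + x))"])
         (auto intro!: divide_nonneg_nonneg mult_nonneg_nonneg)
    then show ?thesis using DERIV_nonneg_imp_nondecreasing[of 0 u g] True by blast
  next
    case False
    have "\<exists>y. (g has_real_derivative y) (at x) \<and> y \<le> 0" if "u \<le> x" "x \<le> 0" for x
      using deriv[of x] that assms
      by (intro exI[of _ "x * (1 - x) / (2 * (1 + x))"])
         (auto intro!: divide_nonpos_nonneg mult_nonpos_nonneg)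
    then show ?thesis using DERIV_nonpos_imp_nonincreasing[of u 0 g] False by force
  qed
  then show ?thesis by (simp add: g_def)
qed

text \<open>
  Concavity: the growth along the segment from 0 to a stake dominates the linear interpolation.
  It transfers a nonnegative growth rate of a large stake to a small multiple of that stake,
  where quadratic estimates of the logarithm apply.
\<close>
lemma ln_one_plus_ge_scaled:
  fixes t u :: real
  assumes "0 < 1 + u" "0 \<le> t" "t \<le> 1"
  shows "t * ln (1 + u) \<le> ln (1 + t * u)"
proof -
  have "(1 - t) * ln 1 + t * ln (1 + u) \<le> ln ((1 - t) *\<^sub>R 1 + t *\<^sub>R (1 + u))"
    by (rule concave_onD[OF ln_concave]) (use assms in auto)
  then show ?thesis by (simp add: algebra_simps)
qed

text \<open>
  The 1-norm is the convenient one: it turns coordinatewise bounds on outcomes and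
  on their moments into bounds on linear and quadratic forms without dimension-dependent factors.
\<close>
definition stake_size :: "nat \<Rightarrow> (nat \<Rightarrow> real) \<Rightarrow> real" where
  "stake_size n v = (\<Sum>k\<in>{1..n}. \<bar>v k\<bar>)"

lemma stake_size_nonneg: "0 \<le> stake_size n v"
  by (simp add: stake_size_def sum_nonneg)

lemma abs_le_stake_size: "k \<in> {1..n} \<Longrightarrow> \<bar>v k\<bar> \<le> stake_size n v"
  unfolding stake_size_def by (rule member_le_sum) auto

lemma abs_dotp_le:
  assumes "\<forall>k\<in>{1..n}. \<bar>z k\<bar> \<le> B"
  shows "\<bar>dotp n y z\<bar> \<le> stake_size n y * B"
proof -
  have "\<bar>dotp n y z\<bar> \<le> (\<Sum>k\<in>{1..n}. \<bar>y k * z k\<bar>)"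
    unfolding dotp_def by (rule sum_abs)
  also have "\<dots> \<le> (\<Sum>k\<in>{1..n}. \<bar>y k\<bar> * B)"
    using assms by (intro sum_mono) (auto simp: abs_mult intro!: mult_left_mono)
  finally show ?thesis by (simp add: stake_size_def sum_distrib_right)
qed

lemma dotp_update:
  "k \<in> {1..n} \<Longrightarrow> dotp n (y(k := y k + h)) z = dotp n y z + h * z k"
proof -
  assume k: "k \<in> {1..n}"
  have "dotp n (y(k := y k + h)) z = (\<Sum>i\<in>{1..n}. y i * z i + (if i = k then h * z k else 0))"
    unfolding dotp_def by (intro sum.cong) (auto simp: algebra_simps)
  then show ?thesis using k by (simp add: sum.distrib dotp_def)
qed

lemma measurable_component_of_vector:
  assumes "Z \<in> measurable M (PiM {1..n} (\<lambda>_. borel))" "k \<in> {1..n}"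
  shows "(\<lambda>\<omega>. Z \<omega> k) \<in> borel_measurable M"
  using measurable_compose[OF assms(1) measurable_component_singleton[OF assms(2)]] by simp

lemma borel_measurable_dotp:
  assumes "Z \<in> measurable M (PiM {1..n} (\<lambda>_. borel))"
  shows "(\<lambda>\<omega>. dotp n y (Z \<omega>)) \<in> borel_measurable M"
  unfolding dotp_def
  by (intro borel_measurable_sum borel_measurable_times borel_measurable_const
        measurable_component_of_vector[OF assms])

section \<open>Extended expectations of logarithms\<close>

lemma log_ext_pos: "0 < t \<Longrightarrow> log_ext t = ereal (ln t)"
  by (simp add: log_ext_def)

lemma expect_ext_log_integrable:
  assumes "AE \<omega> in M. 0 < X \<omega>" and int: "integrable M (\<lambda>\<omega>. ln (X \<omega>))"
  shows "expect_ext M (\<lambda>\<omega>. log_ext (X \<omega>)) = ereal (\<integral>\<omega>. ln (X \<omega>) \<partial>M)"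
proof -
  have 1: "(\<integral>\<^sup>+ \<omega>. e2ennreal (log_ext (X \<omega>)) \<partial>M) = (\<integral>\<^sup>+ \<omega>. ennreal (ln (X \<omega>)) \<partial>M)"
    using assms(1) by (intro nn_integral_cong_AE) (auto simp: log_ext_pos)
  have 2: "(\<integral>\<^sup>+ \<omega>. e2ennreal (- log_ext (X \<omega>)) \<partial>M) = (\<integral>\<^sup>+ \<omega>. ennreal (- ln (X \<omega>)) \<partial>M)"
    using assms(1) by (intro nn_integral_cong_AE) (auto simp: log_ext_pos)
  have fin: "(\<integral>\<^sup>+ \<omega>. ennreal (ln (X \<omega>)) \<partial>M) \<noteq> \<infinity>" "(\<integral>\<^sup>+ \<omega>. ennreal (- ln (X \<omega>)) \<partial>M) \<noteq> \<infinity>"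
    using int by (auto simp: real_integrable_def)
  have conv: "enn2ereal x = ereal (enn2real x)" if "x \<noteq> \<infinity>" for x
    using that by (cases x) (auto simp: enn2ereal_ennreal)
  show ?thesis
    unfolding expect_ext_def 1 2 real_lebesgue_integral_def[OF int]
    using fin by (simp add: conv)
qed

context prob_space
begin

lemma integrable_of_AE_bound:
  fixes f :: "'a \<Rightarrow> real"
  assumes "f \<in> borel_measurable M" "AE \<omega> in M. \<bar>f \<omega>\<bar> \<le> K"
  shows "integrable M f"
  using assms by (intro integrable_const_bound[of _ K]) auto

text \<open>
  A wealth that is bounded above has a finite positive part of log-wealth, so an expected log-wealth
  other than \<open>- \<infinity>\<close> leaves no room for ruin or for a non-integrable negative part.
  This lets extended growth rates of arbitrary stakes be treated as ordinary integrals.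
\<close>
lemma expect_ext_log_integrableD:
  assumes X[measurable]: "X \<in> borel_measurable M" and bound: "AE \<omega> in M. X \<omega> \<le> K"
    and finite: "expect_ext M (\<lambda>\<omega>. log_ext (X \<omega>)) \<noteq> - \<infinity>"
  shows "AE \<omega> in M. 0 < X \<omega>" and "integrable M (\<lambda>\<omega>. ln (X \<omega>))"
proof -
  let ?P = "\<integral>\<^sup>+ \<omega>. e2ennreal (log_ext (X \<omega>)) \<partial>M"
  let ?N = "\<integral>\<^sup>+ \<omega>. e2ennreal (- log_ext (X \<omega>)) \<partial>M"
  have "?P \<le> (\<integral>\<^sup>+ \<omega>. ennreal (ln (max 1 K)) \<partial>M)"
  proof (rule nn_integral_mono_AE, use bound in eventually_elim)
    fix \<omega> assume "X \<omega> \<le> K"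
    then have "0 < X \<omega> \<Longrightarrow> ln (X \<omega>) \<le> ln (max 1 K)" by simp
    then show "e2ennreal (log_ext (X \<omega>)) \<le> ennreal (ln (max 1 K))"
      by (cases "0 < X \<omega>") (auto simp: log_ext_def e2ennreal_neg ennreal_leI)
  qed
  then have P: "?P \<noteq> \<infinity>"
    by (auto simp: emeasure_space_1 top_unique)
  have N: "?N \<noteq> \<infinity>"
  proof
    assume "?N = \<infinity>"
    with P finite show False
      unfolding expect_ext_def by (cases ?P) (auto simp: enn2ereal_ennreal)
  qed
  have [measurable]: "(\<lambda>\<omega>. log_ext (X \<omega>)) \<in> borel_measurable M"
    unfolding log_ext_def by measurable
  have "AE \<omega> in M. e2ennreal (- log_ext (X \<omega>)) \<noteq> \<infinity>"
    by (rule nn_integral_PInf_AE[OF _ N]) measurable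
  then show pos: "AE \<omega> in M. 0 < X \<omega>"
    by eventually_elim (auto simp: log_ext_def split: if_splits)
  have 1: "?P = (\<integral>\<^sup>+ \<omega>. ennreal (ln (X \<omega>)) \<partial>M)"
    using pos by (intro nn_integral_cong_AE) (auto simp: log_ext_pos)
  have 2: "?N = (\<integral>\<^sup>+ \<omega>. ennreal (- ln (X \<omega>)) \<partial>M)"
    using pos by (intro nn_integral_cong_AE) (auto simp: log_ext_pos)
  show "integrable M (\<lambda>\<omega>. ln (X \<omega>))"
    using P N unfolding 1 2 by (auto simp: real_integrable_def)
qed

lemma integrable_ln_one_plus:
  fixes U :: "'a \<Rightarrow> real"
  assumes [measurable]: "U \<in> borel_measurable M" and "AE \<omega> in M. \<bar>U \<omega>\<bar> \<le> 1/2"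
  shows "integrable M (\<lambda>\<omega>. ln (1 + U \<omega>))"
proof (rule integrable_of_AE_bound[where K = 1])
  show "AE \<omega> in M. \<bar>ln (1 + U \<omega>)\<bar> \<le> 1"
    using assms(2)
  proof eventually_elim
    fix \<omega> assume u: "\<bar>U \<omega>\<bar> \<le> 1/2"
    have "(U \<omega>)\<^sup>2 \<le> (1/2)\<^sup>2" using u by (metis abs_ge_zero power2_abs power_mono)
    then show "\<bar>ln (1 + U \<omega>)\<bar> \<le> 1"
      using abs_ln_one_plus_x_minus_x_bound[OF u] u by (simp add: power2_eq_square)
  qed
qed measurable

lemma G_ind_small:
  assumes Z: "Z \<in> measurable M (PiM {1..n} (\<lambda>_. borel))"
    and B: "AE \<omega> in M. \<forall>k\<in>{1..n}. \<bar>Z \<omega> k\<bar> \<le> B"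
    and small: "stake_size n y * B \<le> 1/2"
  shows "AE \<omega> in M. \<bar>dotp n y (Z \<omega>)\<bar> \<le> 1/2"
    and "integrable M (\<lambda>\<omega>. ln (1 + dotp n y (Z \<omega>)))"
    and "G_ind n M Z y = ereal (\<integral>\<omega>. ln (1 + dotp n y (Z \<omega>)) \<partial>M)"
proof -
  show half: "AE \<omega> in M. \<bar>dotp n y (Z \<omega>)\<bar> \<le> 1/2"
    using B by eventually_elim (use abs_dotp_le small in \<open>meson order_trans\<close>)
  show int: "integrable M (\<lambda>\<omega>. ln (1 + dotp n y (Z \<omega>)))"
    by (rule integrable_ln_one_plus[OF borel_measurable_dotp[OF Z] half])
  show "G_ind n M Z y = ereal (\<integral>\<omega>. ln (1 + dotp n y (Z \<omega>)) \<partial>M)"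
    unfolding G_ind_def
    by (rule expect_ext_log_integrable[OF _ int], use half in eventually_elim) (simp add: abs_le_iff)
qed

section \<open>A single block\<close>

text \<open>
  If \<open>t y\<close> is small enough for the quadratic upper bound of the logarithm, the growth rate of
  \<open>t y\<close> is at most \<open>t N \<eta> - q (t N)\<^sup>2 / 4\<close> with \<open>N = stake_size n y\<close>, and by concavity it is
  nonnegative; so \<open>t N q \<le> 4 \<eta>\<close>. If \<open>y\<close> itself were not small, the largest admissible \<open>t\<close>
  would have \<open>t N B = 1/2\<close>, which contradicts \<open>8 \<eta> B < q\<close>.
\<close>
lemma optimal_stake_size_le:
  assumes Z: "Z \<in> measurable M (PiM {1..n} (\<lambda>_. borel))"
    and B: "AE \<omega> in M. \<forall>k\<in>{1..n}. \<bar>Z \<omega> k\<bar> \<le> B" and "0 < B"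
    and mean: "\<And>k. k \<in> {1..n} \<Longrightarrow> \<bar>\<integral>\<omega>. Z \<omega> k \<partial>M\<bar> \<le> \<eta>" and "0 \<le> \<eta>"
    and second: "\<And>v. q * (stake_size n v)\<^sup>2 \<le> (\<integral>\<omega>. (dotp n v (Z \<omega>))\<^sup>2 \<partial>M)" and "0 < q"
    and nonneg: "0 \<le> G_ind n M Z y"
    and low: "8 * \<eta> * B < q"
  shows "stake_size n y * q \<le> 4 * \<eta>"
proof -
  let ?U = "\<lambda>\<omega>. dotp n y (Z \<omega>)" and ?N = "stake_size n y"
  note meas[measurable] = borel_measurable_dotp[OF Z] measurable_component_of_vector[OF Z]
  have bU: "AE \<omega> in M. \<bar>?U \<omega>\<bar> \<le> ?N * B"
    using B by eventually_elim (rule abs_dotp_le)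
  have "AE \<omega> in M. 1 + ?U \<omega> \<le> 1 + ?N * B"
    using bU by eventually_elim simp
  note fin = expect_ext_log_integrableD[OF _ this]
  have ninf: "expect_ext M (\<lambda>\<omega>. log_ext (1 + ?U \<omega>)) \<noteq> - \<infinity>"
    using nonneg unfolding G_ind_def by auto
  have pos: "AE \<omega> in M. 0 < 1 + ?U \<omega>" and int: "integrable M (\<lambda>\<omega>. ln (1 + ?U \<omega>))"
    using fin[OF _ ninf] by simp_all
  have E0: "0 \<le> (\<integral>\<omega>. ln (1 + ?U \<omega>) \<partial>M)"
    using nonneg unfolding G_ind_def expect_ext_log_integrable[OF pos int] by simp
  have intU: "integrable M ?U" by (rule integrable_of_AE_bound[OF _ bU]) simp
  have intU2: "integrable M (\<lambda>\<omega>. (?U \<omega>)\<^sup>2)"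
  proof (rule integrable_of_AE_bound[where K = "(?N * B)\<^sup>2"])
    show "AE \<omega> in M. \<bar>(?U \<omega>)\<^sup>2\<bar> \<le> (?N * B)\<^sup>2"
      using bU by eventually_elim (metis abs_ge_zero abs_power2 power2_abs power_mono)
  qed simp
  have intZ: "integrable M (\<lambda>\<omega>. Z \<omega> k)" if "k \<in> {1..n}" for k
  proof (rule integrable_of_AE_bound[where K = B])
    show "AE \<omega> in M. \<bar>Z \<omega> k\<bar> \<le> B" using B by eventually_elim (use that in blast)
  qed (use that in simp)
  have "(\<integral>\<omega>. ?U \<omega> \<partial>M) = (\<Sum>k\<in>{1..n}. y k * (\<integral>\<omega>. Z \<omega> k \<partial>M))"
    unfolding dotp_def using intZ by (subst Bochner_Integration.integral_sum) auto
  also have "\<dots> \<le> (\<Sum>k\<in>{1..n}. \<bar>y k\<bar> * \<eta>)"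
  proof (rule sum_mono)
    fix k assume "k \<in> {1..n}"
    then have "\<bar>y k * (\<integral>\<omega>. Z \<omega> k \<partial>M)\<bar> \<le> \<bar>y k\<bar> * \<eta>"
      unfolding abs_mult by (intro mult_left_mono mean) auto
    then show "y k * (\<integral>\<omega>. Z \<omega> k \<partial>M) \<le> \<bar>y k\<bar> * \<eta>" by simp
  qed
  finally have EU: "(\<integral>\<omega>. ?U \<omega> \<partial>M) \<le> ?N * \<eta>"
    by (simp add: stake_size_def sum_distrib_right)
  have key: "t * ?N * q \<le> 4 * \<eta>" if t: "0 < t" "t \<le> 1" "t * (?N * B) \<le> 1/2" and N: "0 < ?N" for t
  proof -
    have "0 \<le> t * (\<integral>\<omega>. ln (1 + ?U \<omega>) \<partial>M)" using t E0 by simp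
    also have "\<dots> = (\<integral>\<omega>. t * ln (1 + ?U \<omega>) \<partial>M)" by simp
    also have "\<dots> \<le> (\<integral>\<omega>. t * ?U \<omega> - t\<^sup>2 / 4 * (?U \<omega>)\<^sup>2 \<partial>M)"
    proof (rule integral_mono_AE)
      show "AE \<omega> in M. t * ln (1 + ?U \<omega>) \<le> t * ?U \<omega> - t\<^sup>2 / 4 * (?U \<omega>)\<^sup>2"
        using bU pos
      proof eventually_elim
        fix \<omega> assume u: "\<bar>?U \<omega>\<bar> \<le> ?N * B" "0 < 1 + ?U \<omega>"
        have "\<bar>t * ?U \<omega>\<bar> \<le> 1/2"
          using mult_left_mono[OF u(1), of t] t unfolding abs_mult by linarith
        from ln_one_plus_le_quadratic[OF this] ln_one_plus_ge_scaled[OF u(2), of t] t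
        show "t * ln (1 + ?U \<omega>) \<le> t * ?U \<omega> - t\<^sup>2 / 4 * (?U \<omega>)\<^sup>2"
          by (simp add: power_mult_distrib)
      qed
    qed (use int intU intU2 in auto)
    also have "\<dots> = t * (\<integral>\<omega>. ?U \<omega> \<partial>M) - t\<^sup>2 / 4 * (\<integral>\<omega>. (?U \<omega>)\<^sup>2 \<partial>M)"
      using intU intU2 by simp
    also have "\<dots> \<le> t * (?N * \<eta>) - t\<^sup>2 / 4 * (q * ?N\<^sup>2)"
      using EU second[of y] t by (intro diff_mono mult_left_mono) auto
    also have "\<dots> = (t * ?N / 4) * (4 * \<eta> - t * ?N * q)"
      by (simp add: power2_eq_square algebra_simps)
    finally have "0 \<le> (t * ?N / 4) * (4 * \<eta> - t * ?N * q)" .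
    moreover have "0 < t * ?N / 4" using t N by simp
    ultimately show ?thesis by (metis diff_ge_0_iff_ge not_le zero_le_mult_iff)
  qed
  show ?thesis
  proof (cases "?N = 0")
    case True
    then show ?thesis using \<open>0 \<le> \<eta>\<close> by simp
  next
    case False
    then have N: "0 < ?N" using stake_size_nonneg[of n y] by simp
    show ?thesis
    proof (cases "?N * B \<le> 1/2")
      case True then show ?thesis using key[of 1] N by simp
    next
      case F: False
      have "1 / (2 * (?N * B)) * ?N * q \<le> 4 * \<eta>"
        using F N \<open>0 < B\<close> by (intro key) (auto simp: field_simps)
      then have "q \<le> 8 * \<eta> * B"
        using N \<open>0 < B\<close> by (simp add: field_simps)
      then show ?thesis using low by simp
    qed
  qed
qed

text \<open>
  The first-order condition, without differentiating under the integral: moving the \<open>k\<close>-th stake by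
  \<open>h\<close> of either sign multiplies the wealth by \<open>1 + h Q\<close> with \<open>Q\<close> the integrand below, so maximality
  gives \<open>h E[Q] \<le> O(h\<^sup>2)\<close>, and \<open>h\<close> tends to 0 from both sides.
\<close>
lemma interior_maximum_stationary:
  assumes Z: "Z \<in> measurable M (PiM {1..n} (\<lambda>_. borel))"
    and B: "AE \<omega> in M. \<forall>k\<in>{1..n}. \<bar>Z \<omega> k\<bar> \<le> B" and "0 < B"
    and small: "stake_size n y * B \<le> 1/4"
    and max: "is_arg_max (G_ind n M Z) (stake_vector n) y"
    and k: "k \<in> {1..n}" "0 < y k"
  shows "(\<integral>\<omega>. Z \<omega> k / (1 + dotp n y (Z \<omega>)) \<partial>M) = 0"
proof -
  let ?U = "\<lambda>\<omega>. dotp n y (Z \<omega>)"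
  let ?Q = "\<lambda>\<omega>. Z \<omega> k / (1 + ?U \<omega>)"
  let ?E = "\<integral>\<omega>. ?Q \<omega> \<partial>M"
  note meas[measurable] = borel_measurable_dotp[OF Z] measurable_component_of_vector[OF Z k(1)]
  have half: "AE \<omega> in M. \<bar>?U \<omega>\<bar> \<le> 1/2" and intU: "integrable M (\<lambda>\<omega>. ln (1 + ?U \<omega>))"
    and GU: "G_ind n M Z y = ereal (\<integral>\<omega>. ln (1 + ?U \<omega>) \<partial>M)"
    using G_ind_small[OF Z B, of y] small by auto
  have Q: "AE \<omega> in M. \<bar>?Q \<omega>\<bar> \<le> 2 * B"
    using half B
  proof eventually_elim
    fix \<omega> assume *: "\<bar>?U \<omega>\<bar> \<le> 1/2" "\<forall>k\<in>{1..n}. \<bar>Z \<omega> k\<bar> \<le> B"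
    then have "\<bar>Z \<omega> k\<bar> / \<bar>1 + ?U \<omega>\<bar> \<le> B / (1/2)"
      using k by (intro frac_le) auto
    then show "\<bar>?Q \<omega>\<bar> \<le> 2 * B" by simp
  qed
  have intQ: "integrable M ?Q" by (rule integrable_of_AE_bound[OF _ Q]) simp
  \<comment> \<open>\<open>2 B\<close> bounds \<open>Q\<close>, and \<open>\<bar>ln (1 + u) - u\<bar> \<le> 2 u\<^sup>2\<close> is used with \<open>u = h Q\<close>.\<close>
  have step: "h * ?E \<le> 2 * (h * (2 * B))\<^sup>2" if h: "\<bar>h\<bar> \<le> y k" "\<bar>h\<bar> * B \<le> 1/4" for h
  proof -
    let ?y = "y(k := y k + h)"
    let ?V = "\<lambda>\<omega>. dotp n ?y (Z \<omega>)"
    have V: "?V \<omega> = ?U \<omega> + h * Z \<omega> k" for \<omega> by (rule dotp_update[OF k(1)])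
    have "stake_vector n ?y"
      using max h unfolding is_arg_max_def stake_vector_def by auto
    then have le: "G_ind n M Z ?y \<le> G_ind n M Z y"
      using max unfolding is_arg_max_def by (meson not_le)
    have "stake_size n ?y \<le> (\<Sum>i\<in>{1..n}. \<bar>y i\<bar> + (if i = k then \<bar>h\<bar> else 0))"
      unfolding stake_size_def by (rule sum_mono) auto
    also have "\<dots> = stake_size n y + \<bar>h\<bar>"
      using k by (simp add: sum.distrib stake_size_def)
    finally have "stake_size n ?y * B \<le> (stake_size n y + \<bar>h\<bar>) * B"
      using \<open>0 < B\<close> by simp
    also have "\<dots> \<le> 1/2" using small h by (simp add: distrib_right)
    finally have sV: "stake_size n ?y * B \<le> 1/2" .
    note Gs = G_ind_small[OF Z B sV]
    have ineq: "(\<integral>\<omega>. ln (1 + ?V \<omega>) \<partial>M) - (\<integral>\<omega>. ln (1 + ?U \<omega>) \<partial>M) \<le> 0"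
      using le unfolding Gs(3) GU by simp
    have "h * ?E - 2 * (h * (2 * B))\<^sup>2 = (\<integral>\<omega>. h * ?Q \<omega> - 2 * (h * (2 * B))\<^sup>2 \<partial>M)"
      using intQ by (subst Bochner_Integration.integral_diff) (simp_all only: integrable_mult_right
        integrable_const integral_mult_right_zero lebesgue_integral_const prob_space scaleR_one)
    also have "\<dots> \<le> (\<integral>\<omega>. ln (1 + ?V \<omega>) - ln (1 + ?U \<omega>) \<partial>M)"
    proof (rule integral_mono_AE)
      show "AE \<omega> in M. h * ?Q \<omega> - 2 * (h * (2 * B))\<^sup>2 \<le> ln (1 + ?V \<omega>) - ln (1 + ?U \<omega>)"
        using half Gs(1) Q
      proof eventually_elim
        fix \<omega> assume *: "\<bar>?U \<omega>\<bar> \<le> 1/2" "\<bar>?V \<omega>\<bar> \<le> 1/2" "\<bar>?Q \<omega>\<bar> \<le> 2 * B"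
        have hq: "\<bar>h * ?Q \<omega>\<bar> \<le> \<bar>h\<bar> * (2 * B)"
          unfolding abs_mult[of h] using *(3) by (intro mult_left_mono) auto
        then have hq2: "\<bar>h * ?Q \<omega>\<bar> \<le> 1/2" using h by linarith
        have "(h * ?Q \<omega>)\<^sup>2 \<le> (h * (2 * B))\<^sup>2"
          using hq \<open>0 < B\<close> by (intro abs_le_square_iff[THEN iffD1]) (simp add: abs_mult)
        moreover have "ln (1 + ?V \<omega>) - ln (1 + ?U \<omega>) = ln ((1 + ?V \<omega>) / (1 + ?U \<omega>))"
          using * by (subst ln_div) auto
        moreover have "(1 + ?V \<omega>) / (1 + ?U \<omega>) = 1 + h * ?Q \<omega>"
          using *(1) unfolding V by (simp add: field_simps)
        ultimately show "h * ?Q \<omega> - 2 * (h * (2 * B))\<^sup>2 \<le> ln (1 + ?V \<omega>) - ln (1 + ?U \<omega>)"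
          using abs_ln_one_plus_x_minus_x_bound[OF hq2] by (simp add: abs_le_iff)
      qed
      show "integrable M (\<lambda>\<omega>. h * ?Q \<omega> - 2 * (h * (2 * B))\<^sup>2)"
        by (intro Bochner_Integration.integrable_diff integrable_mult_right intQ integrable_const)
    qed (use intU Gs(2) in auto)
    also have "\<dots> \<le> 0" using ineq intU Gs(2) by simp
    finally show ?thesis by simp
  qed
  have bound: "\<bar>?E\<bar> \<le> 8 * B\<^sup>2 * h" if h: "0 < h" "h \<le> y k" "h \<le> 1 / (4 * B)" for h
  proof -
    have hB: "h * B \<le> 1/4" using h(3) \<open>0 < B\<close> by (simp add: field_simps)
    have "h * ?E \<le> h * (8 * B\<^sup>2 * h)" "h * (- ?E) \<le> h * (8 * B\<^sup>2 * h)"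
      using step[of h] step[of "- h"] h hB by (simp_all add: power2_eq_square algebra_simps)
    then have "?E \<le> 8 * B\<^sup>2 * h" "- ?E \<le> 8 * B\<^sup>2 * h"
      using h(1) by (simp_all only: mult_le_cancel_left_pos)
    then show ?thesis by (rule abs_leI)
  qed
  have "((\<lambda>h. 8 * B\<^sup>2 * h) \<longlongrightarrow> 8 * B\<^sup>2 * 0) (at_right 0)"
    by (intro tendsto_intros)
  moreover have "\<forall>\<^sub>F h in at_right 0. \<bar>?E\<bar> \<le> 8 * B\<^sup>2 * h"
    using k(2) \<open>0 < B\<close> bound
    by (auto simp: eventually_at_right_field intro!: exI[of _ "min (y k) (1 / (4 * B))"])
  ultimately have "\<bar>?E\<bar> \<le> 8 * B\<^sup>2 * 0"
    by (intro tendsto_lowerbound[where F = "at_right 0"]) auto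
  then show ?thesis by simp
qed

text \<open>
  By linearity, no bet on the block has any expected value once discounted by the optimal wealth;
  applied to the optimal stake, \<open>1 / (1 + S) = 1 - S / (1 + S)\<close> gives the last claim.
\<close>
lemma stationary_reciprocal_wealth:
  assumes Z: "Z \<in> measurable M (PiM {1..n} (\<lambda>_. borel))"
    and B: "AE \<omega> in M. \<forall>k\<in>{1..n}. \<bar>Z \<omega> k\<bar> \<le> B"
    and small: "stake_size n y * B \<le> 1/2"
    and stat: "\<And>k. k \<in> {1..n} \<Longrightarrow> (\<integral>\<omega>. Z \<omega> k / (1 + dotp n y (Z \<omega>)) \<partial>M) = 0"
  shows "integrable M (\<lambda>\<omega>. dotp n x (Z \<omega>) / (1 + dotp n y (Z \<omega>)))"
    and "integrable M (\<lambda>\<omega>. 1 / (1 + dotp n y (Z \<omega>)))"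
    and "(\<integral>\<omega>. dotp n x (Z \<omega>) / (1 + dotp n y (Z \<omega>)) \<partial>M) = 0"
    and "(\<integral>\<omega>. 1 / (1 + dotp n y (Z \<omega>)) \<partial>M) = 1"
proof -
  let ?U = "\<lambda>\<omega>. dotp n y (Z \<omega>)"
  note meas[measurable] = borel_measurable_dotp[OF Z] measurable_component_of_vector[OF Z]
  have half: "AE \<omega> in M. \<bar>?U \<omega>\<bar> \<le> 1/2"
    by (rule G_ind_small(1)[OF Z B small])
  show int1: "integrable M (\<lambda>\<omega>. 1 / (1 + ?U \<omega>))"
  proof (rule integrable_of_AE_bound[where K = 2])
    show "AE \<omega> in M. \<bar>1 / (1 + ?U \<omega>)\<bar> \<le> 2"
      using half by eventually_elim (auto simp: abs_le_iff field_simps)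
  qed measurable
  have int: "integrable M (\<lambda>\<omega>. dotp n x (Z \<omega>) / (1 + ?U \<omega>))" for x
  proof (rule integrable_of_AE_bound[where K = "stake_size n x * B * 2"])
    show "AE \<omega> in M. \<bar>dotp n x (Z \<omega>) / (1 + ?U \<omega>)\<bar> \<le> stake_size n x * B * 2"
      using half B
    proof eventually_elim
      fix \<omega> assume *: "\<bar>?U \<omega>\<bar> \<le> 1/2" "\<forall>k\<in>{1..n}. \<bar>Z \<omega> k\<bar> \<le> B"
      have "\<bar>dotp n x (Z \<omega>)\<bar> / \<bar>1 + ?U \<omega>\<bar> \<le> stake_size n x * B / (1/2)"
        using *(1) abs_dotp_le[OF *(2), of x] by (intro frac_le) auto
      then show "\<bar>dotp n x (Z \<omega>) / (1 + ?U \<omega>)\<bar> \<le> stake_size n x * B * 2" by simp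
    qed
  qed measurable
  have intk: "integrable M (\<lambda>\<omega>. Z \<omega> k / (1 + ?U \<omega>))" if k: "k \<in> {1..n}" for k
  proof -
    have "dotp n (\<lambda>i. of_bool (i = k)) z = z k" for z
      using k by (simp add: dotp_def of_bool_def if_distrib[of "\<lambda>c. c * _"] cong: if_cong)
    then show ?thesis using int[of "\<lambda>i. of_bool (i = k)"] by simp
  qed
  have zero: "(\<integral>\<omega>. dotp n x (Z \<omega>) / (1 + ?U \<omega>) \<partial>M) = 0" for x
  proof -
    have "(\<integral>\<omega>. dotp n x (Z \<omega>) / (1 + ?U \<omega>) \<partial>M)
        = (\<integral>\<omega>. (\<Sum>k\<in>{1..n}. x k * (Z \<omega> k / (1 + ?U \<omega>))) \<partial>M)"
      unfolding dotp_def[of n x] by (simp add: sum_divide_distrib)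
    also have "\<dots> = (\<Sum>k\<in>{1..n}. x k * (\<integral>\<omega>. Z \<omega> k / (1 + ?U \<omega>) \<partial>M))"
      using intk by (subst Bochner_Integration.integral_sum)
        (simp_all only: integrable_mult_right integral_mult_right_zero)
    also have "\<dots> = 0" using stat by simp
    finally show ?thesis .
  qed
  show "integrable M (\<lambda>\<omega>. dotp n x (Z \<omega>) / (1 + dotp n y (Z \<omega>)))"
    and "(\<integral>\<omega>. dotp n x (Z \<omega>) / (1 + dotp n y (Z \<omega>)) \<partial>M) = 0" by (rule int zero)+
  have "(\<integral>\<omega>. 1 / (1 + ?U \<omega>) \<partial>M) = (\<integral>\<omega>. 1 - dotp n y (Z \<omega>) / (1 + ?U \<omega>) \<partial>M)"
  proof (rule integral_cong_AE)
    show "AE \<omega> in M. 1 / (1 + ?U \<omega>) = 1 - ?U \<omega> / (1 + ?U \<omega>)"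
      using half by eventually_elim (auto simp: abs_le_iff field_simps)
  qed measurable
  also have "\<dots> = 1" using int zero by (simp add: prob_space)
  finally show "(\<integral>\<omega>. 1 / (1 + ?U \<omega>) \<partial>M) = 1" .
qed

end

section \<open>Singles against parlays\<close>

text \<open>
  The factor \<open>4 ^ card I\<close> is generous: a new factor \<open>1 + s\<close> at most doubles the previous error and
  adds \<open>s\<close> times the previous linear part, which is at most \<open>card I * \<delta>\<^sup>2\<close>.
\<close>
lemma abs_prod_one_plus_minus_linear_le:
  fixes s :: "'i \<Rightarrow> real"
  assumes "finite I" "\<And>i. i \<in> I \<Longrightarrow> \<bar>s i\<bar> \<le> \<delta>" "0 \<le> \<delta>" "\<delta> \<le> 1"
  shows "\<bar>(\<Prod>i\<in>I. 1 + s i) - (1 + (\<Sum>i\<in>I. s i))\<bar> \<le> 4 ^ card I * \<delta>\<^sup>2"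
  using assms(1,2)
proof (induction I rule: finite_induct)
  case (insert i I)
  let ?P = "\<Prod>i\<in>I. 1 + s i" and ?S = "\<Sum>i\<in>I. s i"
  have IH: "\<bar>?P - (1 + ?S)\<bar> \<le> 4 ^ card I * \<delta>\<^sup>2" using insert by auto
  have si: "\<bar>s i\<bar> \<le> \<delta>" using insert by auto
  have "\<bar>?S\<bar> \<le> (\<Sum>i\<in>I. \<bar>s i\<bar>)" by (rule sum_abs)
  also have "\<dots> \<le> (\<Sum>i\<in>I. \<delta>)" using insert by (intro sum_mono) auto
  finally have S: "\<bar>?S\<bar> \<le> card I * \<delta>" by simp
  have "real (card I) \<le> 2 ^ card I" using of_nat_less_two_power[of "card I"] by (simp add: less_imp_le)
  also have "\<dots> \<le> 4 ^ card I" by (intro power_mono) auto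
  finally have c: "real (card I) \<le> 4 ^ card I" .
  have "\<bar>(\<Prod>i\<in>insert i I. 1 + s i) - (1 + (\<Sum>i\<in>insert i I. s i))\<bar>
      = \<bar>(?P - (1 + ?S)) * (1 + s i) + s i * ?S\<bar>"
    using insert by (simp add: algebra_simps)
  also have "\<dots> \<le> \<bar>?P - (1 + ?S)\<bar> * \<bar>1 + s i\<bar> + \<bar>s i\<bar> * \<bar>?S\<bar>"
    by (metis abs_mult abs_triangle_ineq)
  also have "\<dots> \<le> (4 ^ card I * \<delta>\<^sup>2) * 2 + \<delta> * (card I * \<delta>)"
    using IH S si assms(3,4) by (intro add_mono mult_mono) auto
  also have "\<delta> * (card I * \<delta>) \<le> 4 ^ card I * \<delta>\<^sup>2"
    using mult_right_mono[OF c, of "\<delta>\<^sup>2"] by (simp add: power2_eq_square algebra_simps)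
  also have "(4 ^ card I * \<delta>\<^sup>2) * 2 + 4 ^ card I * \<delta>\<^sup>2 \<le> 4 ^ card (insert i I) * \<delta>\<^sup>2"
    using insert by simp
  finally show ?case by simp
qed simp

context prob_space
begin

text \<open>
  Expanding the numerator, \<open>W\<^sub>x / P\<close> is \<open>\<Prod>\<^sub>i 1 / (1 + S\<^sub>i)\<close> plus, for each \<open>j\<close>, the same product with
  \<open>x\<^sub>j \<bullet> Z\<^sub>j / (1 + S\<^sub>j)\<close> as the \<open>j\<close>-th factor. By independence the expectations factor, the first
  term into factors 1 and each of the others into factors 1 and one factor 0.
\<close>
lemma expected_singles_over_parlay:
  fixes m :: nat and d :: "nat \<Rightarrow> nat"
  assumes indep: "indep_vars (\<lambda>j. PiM {1..d j} (\<lambda>_. borel)) Z {1..m}"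
    and B: "\<forall>j\<in>{1..m}. AE \<omega> in M. \<forall>k\<in>{1..d j}. \<bar>Z j \<omega> k\<bar> \<le> B"
    and small: "\<forall>j\<in>{1..m}. stake_size (d j) (y j) * B \<le> 1/2"
    and stat: "\<forall>j\<in>{1..m}. \<forall>k\<in>{1..d j}. (\<integral>\<omega>. Z j \<omega> k / (1 + dotp (d j) (y j) (Z j \<omega>)) \<partial>M) = 0"
  shows "integrable M (\<lambda>\<omega>. (1 + (\<Sum>j\<in>{1..m}. dotp (d j) (x j) (Z j \<omega>)))
            / (\<Prod>j\<in>{1..m}. 1 + dotp (d j) (y j) (Z j \<omega>)))"
    and "(\<integral>\<omega>. (1 + (\<Sum>j\<in>{1..m}. dotp (d j) (x j) (Z j \<omega>)))
            / (\<Prod>j\<in>{1..m}. 1 + dotp (d j) (y j) (Z j \<omega>)) \<partial>M) = 1"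
proof -
  let ?I = "{1..m}"
  define f where "f i z = 1 / (1 + dotp (d i) (y i) z)" for i :: nat and z
  define g where "g i z = dotp (d i) (x i) z / (1 + dotp (d i) (y i) z)" for i :: nat and z
  \<comment> \<open>The factors of the \<open>j\<close>-th mixed term.\<close>
  define F where "F j i z = (if i = j then g i z else f i z)" for i j :: nat and z
  have Z: "Z i \<in> measurable M (PiM {1..d i} (\<lambda>_. borel))" if "i \<in> ?I" for i
    using indep that by (simp add: indep_vars_def)
  note single = stationary_reciprocal_wealth[OF Z B[rule_format] small[rule_format] stat[rule_format]]
  have meas[measurable]: "(\<lambda>z. dotp (d i) v z) \<in> borel_measurable (PiM {1..d i} (\<lambda>_. borel))" for i v
    using borel_measurable_dotp[OF measurable_ident] by (simp add: id_def)
  have f: "integrable M (\<lambda>\<omega>. f i (Z i \<omega>))" "(\<integral>\<omega>. f i (Z i \<omega>) \<partial>M) = 1"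
    and g: "integrable M (\<lambda>\<omega>. g i (Z i \<omega>))" "(\<integral>\<omega>. g i (Z i \<omega>) \<partial>M) = 0" if "i \<in> ?I" for i
    unfolding f_def g_def using single[of i] that by auto
  have "indep_vars (\<lambda>_. borel) (\<lambda>i \<omega>. f i (Z i \<omega>)) ?I"
    by (rule indep_vars_compose2[OF indep]) (unfold f_def, measurable)
  note indep_f = indep_vars_lebesgue_integral[OF _ this] indep_vars_integrable[OF _ this]
  have "indep_vars (\<lambda>_. borel) (\<lambda>i \<omega>. F j i (Z i \<omega>)) ?I" for j
    by (rule indep_vars_compose2[OF indep]) (unfold F_def f_def g_def, measurable)
  note indep_F = indep_vars_lebesgue_integral[OF _ this] indep_vars_integrable[OF _ this]
  have F: "integrable M (\<lambda>\<omega>. F j i (Z i \<omega>))"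
    "(\<integral>\<omega>. F j i (Z i \<omega>) \<partial>M) = (if i = j then 0 else 1)" if "i \<in> ?I" for i j
    using f[OF that] g[OF that] by (cases "i = j"; simp add: F_def)+
  have intP: "integrable M (\<lambda>\<omega>. \<Prod>i\<in>?I. f i (Z i \<omega>))" "(\<integral>\<omega>. (\<Prod>i\<in>?I. f i (Z i \<omega>)) \<partial>M) = 1"
    using indep_f f by simp_all
  have intF: "integrable M (\<lambda>\<omega>. \<Prod>i\<in>?I. F j i (Z i \<omega>))"
    "(\<integral>\<omega>. (\<Prod>i\<in>?I. F j i (Z i \<omega>)) \<partial>M) = 0" if "j \<in> ?I" for j
    using indep_F[of j] F that by (auto intro!: prod_zero)
  have F_prod: "(\<Prod>i\<in>?I. F j i (Z i \<omega>)) = dotp (d j) (x j) (Z j \<omega>) * (\<Prod>i\<in>?I. f i (Z i \<omega>))"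
    if "j \<in> ?I" for j \<omega>
  proof -
    have "(\<Prod>i\<in>?I. F j i (Z i \<omega>))
        = (\<Prod>i\<in>?I. (if i = j then dotp (d i) (x i) (Z i \<omega>) else 1) * f i (Z i \<omega>))"
      by (intro prod.cong) (auto simp: F_def f_def g_def)
    then show ?thesis using that by (simp add: prod.distrib)
  qed
  have eq: "(1 + (\<Sum>j\<in>?I. dotp (d j) (x j) (Z j \<omega>))) / (\<Prod>j\<in>?I. 1 + dotp (d j) (y j) (Z j \<omega>))
      = (\<Prod>i\<in>?I. f i (Z i \<omega>)) + (\<Sum>j\<in>?I. \<Prod>i\<in>?I. F j i (Z i \<omega>))" for \<omega>
  proof -
    have "(\<Prod>i\<in>?I. f i (Z i \<omega>)) = 1 / (\<Prod>j\<in>?I. 1 + dotp (d j) (y j) (Z j \<omega>))"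
      by (simp add: f_def prod_dividef)
    moreover have "(\<Sum>j\<in>?I. \<Prod>i\<in>?I. F j i (Z i \<omega>))
        = (\<Sum>j\<in>?I. dotp (d j) (x j) (Z j \<omega>)) * (\<Prod>i\<in>?I. f i (Z i \<omega>))"
      unfolding sum_distrib_right by (intro sum.cong refl F_prod)
    ultimately show ?thesis by (simp add: add_divide_distrib)
  qed
  show "integrable M (\<lambda>\<omega>. (1 + (\<Sum>j\<in>?I. dotp (d j) (x j) (Z j \<omega>)))
            / (\<Prod>j\<in>?I. 1 + dotp (d j) (y j) (Z j \<omega>)))"
    unfolding eq by (intro Bochner_Integration.integrable_add Bochner_Integration.integrable_sum intP intF)
  show "(\<integral>\<omega>. (1 + (\<Sum>j\<in>?I. dotp (d j) (x j) (Z j \<omega>)))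
            / (\<Prod>j\<in>?I. 1 + dotp (d j) (y j) (Z j \<omega>)) \<partial>M) = 1"
    unfolding eq using intP intF
    by (subst Bochner_Integration.integral_add)
       (auto intro!: Bochner_Integration.integrable_sum simp: Bochner_Integration.integral_sum)
qed

text \<open>
  The two bounds on the gap for a fixed parameter. The condition \<open>8 ^ m * \<delta>\<^sup>2 \<le> 1/2\<close> keeps \<open>R\<close> in the
  range of the quadratic estimate of \<open>ln (1 + R)\<close>; it also shows that betting the isolated stakes
  simultaneously avoids ruin, since \<open>W\<^sub>y = P (1 + R)\<close>.
\<close>
lemma parlay_value_sandwich:
  fixes m :: nat and d :: "nat \<Rightarrow> nat"
  assumes indep: "indep_vars (\<lambda>j. PiM {1..d j} (\<lambda>_. borel)) Z {1..m}"
    and B: "\<forall>j\<in>{1..m}. AE \<omega> in M. \<forall>k\<in>{1..d j}. \<bar>Z j \<omega> k\<bar> \<le> B" and "0 < B"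
    and small: "\<forall>j\<in>{1..m}. stake_size (d j) (y j) * B \<le> \<delta>" "0 \<le> \<delta>" "\<delta> \<le> 1/4" "8 ^ m * \<delta>\<^sup>2 \<le> 1/2"
    and max_y: "\<forall>j\<in>{1..m}. is_arg_max (G_ind (d j) M (Z j)) (stake_vector (d j)) (y j)"
    and interior: "\<forall>j\<in>{1..m}. \<forall>k\<in>{1..d j}. 0 < y j k"
    and max_x: "is_arg_max (G_sing m d M Z) (stake_profile m d) x"
  shows "\<exists>p s. (\<Sum>j\<in>{1..m}. G_ind (d j) M (Z j) (y j)) = ereal p \<and> G_sing m d M Z x = ereal s \<and>
               s \<le> p \<and> p - s \<le> 2 * 64 ^ m * \<delta> ^ 4"
proof -
  let ?I = "{1..m}"
  define S where "S v \<omega> = (\<Sum>j\<in>?I. dotp (d j) (v j) (Z j \<omega>))" for v \<omega>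
  define P where "P \<omega> = (\<Prod>j\<in>?I. 1 + dotp (d j) (y j) (Z j \<omega>))" for \<omega>
  define p where "p = (\<Sum>j\<in>?I. \<integral>\<omega>. ln (1 + dotp (d j) (y j) (Z j \<omega>)) \<partial>M)"
  have Z: "Z i \<in> measurable M (PiM {1..d i} (\<lambda>_. borel))" if "i \<in> ?I" for i
    using indep that by (simp add: indep_vars_def)
  have meas: "(\<lambda>\<omega>. dotp (d j) v (Z j \<omega>)) \<in> borel_measurable M" if "j \<in> ?I" for j v
    by (rule borel_measurable_dotp[OF Z[OF that]])
  have [measurable]: "S v \<in> borel_measurable M" for v
    unfolding S_def using meas by (intro borel_measurable_sum)
  have [measurable]: "P \<in> borel_measurable M"
    unfolding P_def using meas by (intro borel_measurable_prod borel_measurable_add) auto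
  have half: "\<forall>j\<in>?I. stake_size (d j) (y j) * B \<le> 1/2"
    and quarter: "\<forall>j\<in>?I. stake_size (d j) (y j) * B \<le> 1/4"
    using small by force+
  note Gy = G_ind_small[OF Z B[rule_format] half[rule_format]]
  have stat: "\<forall>j\<in>?I. \<forall>k\<in>{1..d j}. (\<integral>\<omega>. Z j \<omega> k / (1 + dotp (d j) (y j) (Z j \<omega>)) \<partial>M) = 0"
    using interior_maximum_stationary[OF Z B[rule_format] \<open>0 < B\<close> quarter[rule_format] max_y[rule_format]]
      interior by blast
  have ratio: "integrable M (\<lambda>\<omega>. (1 + S v \<omega>) / P \<omega>)" "(\<integral>\<omega>. (1 + S v \<omega>) / P \<omega> \<partial>M) = 1" for v
    unfolding S_def P_def using expected_singles_over_parlay[OF indep B half stat] by blast+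
  have par: "(\<Sum>j\<in>?I. G_ind (d j) M (Z j) (y j)) = ereal p"
    unfolding p_def using Gy(3) by (simp flip: sum_ereal)
  have "AE \<omega> in M. \<forall>j\<in>?I. \<forall>k\<in>{1..d j}. \<bar>Z j \<omega> k\<bar> \<le> B"
    using B by (simp add: AE_ball_countable)
  then have bS: "AE \<omega> in M. \<forall>j\<in>?I. \<forall>v. \<bar>dotp (d j) v (Z j \<omega>)\<bar> \<le> stake_size (d j) v * B"
    by eventually_elim (use abs_dotp_le in blast)
  then have b\<delta>: "AE \<omega> in M. \<forall>j\<in>?I. \<bar>dotp (d j) (y j) (Z j \<omega>)\<bar> \<le> \<delta>"
    by eventually_elim (use small(1) in \<open>meson order_trans\<close>)
  have P_pos: "AE \<omega> in M. 0 < P \<omega> \<and> ln (P \<omega>) = (\<Sum>j\<in>?I. ln (1 + dotp (d j) (y j) (Z j \<omega>)))"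
    using b\<delta>
  proof eventually_elim
    fix \<omega> assume *: "\<forall>j\<in>?I. \<bar>dotp (d j) (y j) (Z j \<omega>)\<bar> \<le> \<delta>"
    have pos: "0 < 1 + dotp (d j) (y j) (Z j \<omega>)" if "j \<in> ?I" for j
      using *[rule_format, OF that] small(3) by (simp add: abs_le_iff)
    then show "0 < P \<omega> \<and> ln (P \<omega>) = (\<Sum>j\<in>?I. ln (1 + dotp (d j) (y j) (Z j \<omega>)))"
      unfolding P_def by (intro conjI prod_pos ln_prod) (use pos in force)+
  qed
  have lnP: "integrable M (\<lambda>\<omega>. ln (P \<omega>))" "(\<integral>\<omega>. ln (P \<omega>) \<partial>M) = p"
  proof -
    let ?L = "\<lambda>\<omega>. \<Sum>j\<in>?I. ln (1 + dotp (d j) (y j) (Z j \<omega>))"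
    have ae: "AE \<omega> in M. ?L \<omega> = ln (P \<omega>)" using P_pos by eventually_elim simp
    have L: "integrable M ?L" using Gy(2) by (intro Bochner_Integration.integrable_sum)
    show "integrable M (\<lambda>\<omega>. ln (P \<omega>))"
      by (rule integrable_cong_AE_imp[OF L _ ae]) measurable
    have "(\<integral>\<omega>. ln (P \<omega>) \<partial>M) = (\<integral>\<omega>. ?L \<omega> \<partial>M)"
      using ae L by (intro integral_cong_AE) auto
    also have "\<dots> = p" unfolding p_def using Gy(2) by (intro Bochner_Integration.integral_sum)
    finally show "(\<integral>\<omega>. ln (P \<omega>) \<partial>M) = p" .
  qed
  have upper: "G_sing m d M Z v \<le> ereal p" for v
  proof (cases "G_sing m d M Z v = - \<infinity>")
    case False
    have ninf: "expect_ext M (\<lambda>\<omega>. log_ext (1 + S v \<omega>)) \<noteq> - \<infinity>"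
      using False by (simp add: G_sing_def S_def)
    have bound: "AE \<omega> in M. 1 + S v \<omega> \<le> 1 + (\<Sum>j\<in>?I. stake_size (d j) (v j) * B)"
      using bS by eventually_elim (auto simp: S_def abs_le_iff intro!: sum_mono)
    have pos: "AE \<omega> in M. 0 < 1 + S v \<omega>" and int: "integrable M (\<lambda>\<omega>. ln (1 + S v \<omega>))"
      using expect_ext_log_integrableD[OF _ bound ninf] by simp_all
    have "(\<integral>\<omega>. ln (1 + S v \<omega>) \<partial>M) - p = (\<integral>\<omega>. ln (1 + S v \<omega>) - ln (P \<omega>) \<partial>M)"
      using int lnP by simp
    also have "\<dots> \<le> (\<integral>\<omega>. (1 + S v \<omega>) / P \<omega> - 1 \<partial>M)"
    proof (rule integral_mono_AE)
      show "AE \<omega> in M. ln (1 + S v \<omega>) - ln (P \<omega>) \<le> (1 + S v \<omega>) / P \<omega> - 1"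
        using pos P_pos
      proof eventually_elim
        fix \<omega> assume "0 < 1 + S v \<omega>"
          and "0 < P \<omega> \<and> ln (P \<omega>) = (\<Sum>j\<in>?I. ln (1 + dotp (d j) (y j) (Z j \<omega>)))"
        then show "ln (1 + S v \<omega>) - ln (P \<omega>) \<le> (1 + S v \<omega>) / P \<omega> - 1"
          using ln_le_minus_one[of "(1 + S v \<omega>) / P \<omega>"] by (simp add: ln_div)
      qed
    qed (use int lnP ratio in auto)
    also have "\<dots> = 0" using ratio[of v] by (simp add: prob_space)
    finally have "(\<integral>\<omega>. ln (1 + S v \<omega>) \<partial>M) \<le> p" by simp
    then show ?thesis
      using expect_ext_log_integrable[OF pos int] by (simp add: G_sing_def S_def)
  qed simp
  have lower: "ereal (p - 2 * 64 ^ m * \<delta> ^ 4) \<le> G_sing m d M Z y"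
  proof -
    define R where "R \<omega> = (1 + S y \<omega>) / P \<omega> - 1" for \<omega>
    have [measurable]: "R \<in> borel_measurable M" unfolding R_def by measurable
    have R: "AE \<omega> in M. \<bar>R \<omega>\<bar> \<le> 8 ^ m * \<delta>\<^sup>2"
      using b\<delta> P_pos
    proof eventually_elim
      fix \<omega> assume *: "\<forall>j\<in>?I. \<bar>dotp (d j) (y j) (Z j \<omega>)\<bar> \<le> \<delta>"
        and P: "0 < P \<omega> \<and> ln (P \<omega>) = (\<Sum>j\<in>?I. ln (1 + dotp (d j) (y j) (Z j \<omega>)))"
      have num: "\<bar>1 + S y \<omega> - P \<omega>\<bar> \<le> 4 ^ m * \<delta>\<^sup>2"
        using abs_prod_one_plus_minus_linear_le[of ?I "\<lambda>j. dotp (d j) (y j) (Z j \<omega>)" \<delta>] * small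
        by (simp add: P_def S_def abs_minus_commute)
      \<comment> \<open>Dividing by \<open>P \<ge> 2 ^ - m\<close> turns the factor \<open>4 ^ m\<close> into \<open>8 ^ m\<close>.\<close>
      have "(\<Prod>j\<in>?I. 1/2 :: real) \<le> P \<omega>"
        unfolding P_def
      proof (rule prod_mono)
        fix j assume "j \<in> ?I"
        with * have "\<bar>dotp (d j) (y j) (Z j \<omega>)\<bar> \<le> \<delta>" by blast
        then show "0 \<le> (1/2::real) \<and> 1/2 \<le> 1 + dotp (d j) (y j) (Z j \<omega>)"
          using small(3) by (simp add: abs_le_iff)
      qed
      then have den: "(1/2) ^ m \<le> P \<omega>" by simp
      have "\<bar>R \<omega>\<bar> = \<bar>1 + S y \<omega> - P \<omega>\<bar> / P \<omega>"
        using P by (simp add: R_def diff_divide_distrib[symmetric] abs_if field_simps)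
      also have "\<dots> \<le> 4 ^ m * \<delta>\<^sup>2 / (1/2) ^ m"
        using num den by (intro frac_le) auto
      also have "\<dots> = 8 ^ m * \<delta>\<^sup>2"
        by (simp add: power_one_over flip: power_mult_distrib)
      finally show "\<bar>R \<omega>\<bar> \<le> 8 ^ m * \<delta>\<^sup>2" .
    qed
    then have R_half: "AE \<omega> in M. \<bar>R \<omega>\<bar> \<le> 1/2"
      by eventually_elim (use small in linarith)
    have intR: "integrable M R" "(\<integral>\<omega>. R \<omega> \<partial>M) = 0"
      unfolding R_def using ratio[of y] by (simp_all add: prob_space)
    have intlnR: "integrable M (\<lambda>\<omega>. ln (1 + R \<omega>))"
      by (rule integrable_ln_one_plus[OF _ R_half]) measurable
    have split: "AE \<omega> in M. 0 < 1 + S y \<omega> \<and> ln (P \<omega>) + ln (1 + R \<omega>) = ln (1 + S y \<omega>)"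
      using R_half P_pos
    proof eventually_elim
      fix \<omega> assume "\<bar>R \<omega>\<bar> \<le> 1/2"
        and P: "0 < P \<omega> \<and> ln (P \<omega>) = (\<Sum>j\<in>?I. ln (1 + dotp (d j) (y j) (Z j \<omega>)))"
      then have "0 < 1 + R \<omega>" by (simp add: abs_le_iff)
      moreover have "1 + S y \<omega> = P \<omega> * (1 + R \<omega>)" using P by (simp add: R_def)
      ultimately show "0 < 1 + S y \<omega> \<and> ln (P \<omega>) + ln (1 + R \<omega>) = ln (1 + S y \<omega>)"
        using P by (simp add: ln_mult)
    qed
    have pos: "AE \<omega> in M. 0 < 1 + S y \<omega>" using split by eventually_elim simp
    have eq: "AE \<omega> in M. ln (P \<omega>) + ln (1 + R \<omega>) = ln (1 + S y \<omega>)"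
      using split by eventually_elim simp
    have int: "integrable M (\<lambda>\<omega>. ln (1 + S y \<omega>))"
      by (rule integrable_cong_AE_imp[OF Bochner_Integration.integrable_add[OF lnP(1) intlnR] _ eq])
        measurable
    have "0 - 2 * (8 ^ m * \<delta>\<^sup>2)\<^sup>2 = (\<integral>\<omega>. R \<omega> - 2 * (8 ^ m * \<delta>\<^sup>2)\<^sup>2 \<partial>M)"
      using intR by (simp add: prob_space)
    also have "\<dots> \<le> (\<integral>\<omega>. ln (1 + R \<omega>) \<partial>M)"
    proof (rule integral_mono_AE)
      show "AE \<omega> in M. R \<omega> - 2 * (8 ^ m * \<delta>\<^sup>2)\<^sup>2 \<le> ln (1 + R \<omega>)"
        using R R_half
      proof eventually_elim
        fix \<omega> assume *: "\<bar>R \<omega>\<bar> \<le> 8 ^ m * \<delta>\<^sup>2" "\<bar>R \<omega>\<bar> \<le> 1/2"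
        then have "(R \<omega>)\<^sup>2 \<le> (8 ^ m * \<delta>\<^sup>2)\<^sup>2"
          by (intro abs_le_square_iff[THEN iffD1]) simp
        then show "R \<omega> - 2 * (8 ^ m * \<delta>\<^sup>2)\<^sup>2 \<le> ln (1 + R \<omega>)"
          using abs_ln_one_plus_x_minus_x_bound[OF *(2)] by (simp add: abs_le_iff)
      qed
    qed (use intR intlnR in auto)
    finally have "p - 2 * (8 ^ m * \<delta>\<^sup>2)\<^sup>2 \<le> (\<integral>\<omega>. ln (P \<omega>) + ln (1 + R \<omega>) \<partial>M)"
      using lnP intlnR by simp
    also have "\<dots> = (\<integral>\<omega>. ln (1 + S y \<omega>) \<partial>M)"
      using split by (intro integral_cong_AE) auto
    also have "2 * (8 ^ m * \<delta>\<^sup>2)\<^sup>2 = 2 * 64 ^ m * \<delta> ^ 4"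
      by (simp add: power_mult_distrib power2_eq_square power4_eq_xxxx flip: power_mult_distrib)
    finally show ?thesis
      using expect_ext_log_integrable[OF pos int] by (simp add: G_sing_def S_def)
  qed
  have "stake_profile m d y"
    using max_y unfolding stake_profile_def is_arg_max_def by blast
  then have "G_sing m d M Z y \<le> G_sing m d M Z x"
    using max_x unfolding is_arg_max_def by (meson not_le)
  then have "ereal (p - 2 * 64 ^ m * \<delta> ^ 4) \<le> G_sing m d M Z x"
    using lower by (rule order_trans[rotated])
  then show ?thesis
    using upper[of x] par by (cases "G_sing m d M Z x") auto
qed

end

section \<open>Optimal stakes are of first order\<close>

text \<open>
  The quadratic form attains a positive minimum on the unit sphere of the 1-norm and scales
  quadratically. Vectors are functions on \<open>nat\<close>, so the sphere is made compact by fixing the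
  irrelevant coordinates to 0, as a closed subset of a product of compact sets.
\<close>
lemma positive_definite_mat_coercive:
  assumes "positive_definite_mat n A"
  obtains q where "0 < q"
    "\<And>v. q * (stake_size n v)\<^sup>2 \<le> (\<Sum>k\<in>{1..n}. \<Sum>l\<in>{1..n}. v k * A k l * v l)"
proof (cases "n = 0")
  case True
  show ?thesis by (rule that[of 1]) (use True in \<open>auto simp: stake_size_def\<close>)
next
  case False
  let ?Q = "\<lambda>v. \<Sum>k\<in>{1..n}. \<Sum>l\<in>{1..n}. v k * A k l * v l :: real"
  define K where "K = (PiE UNIV (\<lambda>k. if k \<in> {1..n} then {-1..1::real} else {0})) \<inter> {v. stake_size n v = 1}"
  have coord [continuous_intros]: "continuous_on UNIV (\<lambda>v. v k)" for k :: nat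
    by (rule continuous_on_product_coordinates)
  have "compactin (product_topology (\<lambda>_. euclidean) UNIV) (PiE UNIV (\<lambda>k::nat. if k \<in> {1..n} then {-1..1::real} else {0}))"
    by (auto simp: compactin_PiE)
  then have "compact (PiE UNIV (\<lambda>k::nat. if k \<in> {1..n} then {-1..1::real} else {0}))"
    by (simp add: euclidean_product_topology)
  moreover have "closed {v. stake_size n v = 1}"
    unfolding stake_size_def by (intro closed_Collect_eq continuous_intros)
  ultimately have K: "compact K" unfolding K_def by (rule compact_Int_closed)
  have "(\<lambda>k. if k = 1 then 1 else 0) \<in> K"
    using False by (auto simp: K_def stake_size_def if_distrib[of abs] cong: if_cong)
  then have "K \<noteq> {}" by blast
  moreover have "continuous_on K ?Q"
    by (rule continuous_on_subset[of UNIV]) (auto intro!: continuous_intros)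
  ultimately obtain w where w: "w \<in> K" "\<And>v. v \<in> K \<Longrightarrow> ?Q w \<le> ?Q v"
    using continuous_attains_inf[OF K] by blast
  have "\<exists>k\<in>{1..n}. w k \<noteq> 0"
  proof (rule ccontr)
    assume "\<not> ?thesis"
    then have "stake_size n w = 0" by (simp add: stake_size_def)
    then show False using w(1) by (simp add: K_def)
  qed
  then have "0 < ?Q w" using assms by (simp add: positive_definite_mat_def)
  moreover have "?Q w * (stake_size n v)\<^sup>2 \<le> ?Q v" for v
  proof (cases "stake_size n v = 0")
    case True
    then have "v k = 0" if "k \<in> {1..n}" for k
      using abs_le_stake_size[OF that, of v] by simp
    then have "?Q v = 0" by simp
    then show ?thesis using True by simp
  next
    case False
    let ?N = "stake_size n v"
    let ?v = "\<lambda>k. if k \<in> {1..n} then v k / ?N else 0"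
    have N: "0 < ?N" using False stake_size_nonneg[of n v] by simp
    have "stake_size n ?v = (\<Sum>k\<in>{1..n}. \<bar>v k\<bar> / ?N)"
      unfolding stake_size_def using N by (intro sum.cong) (auto simp: stake_size_def)
    also have "\<dots> = 1" using N by (simp add: stake_size_def flip: sum_divide_distrib)
    finally have one: "stake_size n ?v = 1" .
    moreover have "?v k \<in> (if k \<in> {1..n} then {-1..1} else {0})" for k
    proof (cases "k \<in> {1..n}")
      case True
      from abs_le_stake_size[OF this, of ?v] have "\<bar>?v k\<bar> \<le> 1" unfolding one .
      then have "\<bar>v k / ?N\<bar> \<le> 1" unfolding if_P[OF True] .
      then have "v k / ?N \<in> {-1..1}" unfolding abs_le_iff atLeastAtMost_iff by linarith
      then show ?thesis unfolding if_P[OF True] .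
    qed auto
    ultimately have "?v \<in> K" by (auto simp: K_def)
    then have "?Q w \<le> ?Q ?v" by (rule w(2))
    also have "?Q ?v = (\<Sum>k\<in>{1..n}. \<Sum>l\<in>{1..n}. v k * A k l * v l / ?N\<^sup>2)"
      by (intro sum.cong) (auto simp: power2_eq_square)
    also have "\<dots> = ?Q v / ?N\<^sup>2" by (simp add: sum_divide_distrib)
    finally show ?thesis using N by (simp add: field_simps)
  qed
  ultimately show ?thesis by (rule that)
qed

text \<open>
  Coercivity survives an entrywise perturbation: an error of \<open>q\<close> per entry changes the form by at most
  \<open>q\<close> times the squared 1-norm, which costs half of the constant.
\<close>
lemma (in prob_space) second_moment_coercive:
  assumes Z: "Z \<in> measurable M (PiM {1..n} (\<lambda>_. borel))"
    and B: "AE \<omega> in M. \<forall>k\<in>{1..n}. \<bar>Z \<omega> k\<bar> \<le> B"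
    and q: "\<And>v. 2 * q * (stake_size n v)\<^sup>2 \<le> (\<Sum>k\<in>{1..n}. \<Sum>l\<in>{1..n}. v k * A k l * v l)"
    and close: "\<forall>k\<in>{1..n}. \<forall>l\<in>{1..n}. \<bar>(\<integral>\<omega>. Z \<omega> k * Z \<omega> l \<partial>M) - A k l\<bar> \<le> q"
  shows "q * (stake_size n v)\<^sup>2 \<le> (\<integral>\<omega>. (dotp n v (Z \<omega>))\<^sup>2 \<partial>M)"
proof -
  let ?E = "\<lambda>k l. \<integral>\<omega>. Z \<omega> k * Z \<omega> l \<partial>M"
  note [measurable] = measurable_component_of_vector[OF Z]
  have int: "integrable M (\<lambda>\<omega>. Z \<omega> k * Z \<omega> l)" if "k \<in> {1..n}" "l \<in> {1..n}" for k l
  proof (rule integrable_of_AE_bound[where K = "B * B"])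
    show "AE \<omega> in M. \<bar>Z \<omega> k * Z \<omega> l\<bar> \<le> B * B"
      using B
    proof eventually_elim
      fix \<omega> assume "\<forall>k\<in>{1..n}. \<bar>Z \<omega> k\<bar> \<le> B"
      with that have "\<bar>Z \<omega> k\<bar> \<le> B" "\<bar>Z \<omega> l\<bar> \<le> B" by blast+
      then show "\<bar>Z \<omega> k * Z \<omega> l\<bar> \<le> B * B"
        unfolding abs_mult by (intro mult_mono) auto
    qed
  qed (use that in measurable)
  have "(\<integral>\<omega>. (dotp n v (Z \<omega>))\<^sup>2 \<partial>M) = (\<integral>\<omega>. (\<Sum>k\<in>{1..n}. \<Sum>l\<in>{1..n}. v k * v l * (Z \<omega> k * Z \<omega> l)) \<partial>M)"
    by (simp add: dotp_def power2_eq_square sum_product mult_ac)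
  also have "\<dots> = (\<Sum>k\<in>{1..n}. \<Sum>l\<in>{1..n}. v k * v l * ?E k l)"
    using int by (subst Bochner_Integration.integral_sum Bochner_Integration.integrable_sum; simp)+
  finally have E: "(\<integral>\<omega>. (dotp n v (Z \<omega>))\<^sup>2 \<partial>M) = (\<Sum>k\<in>{1..n}. \<Sum>l\<in>{1..n}. v k * v l * ?E k l)" .
  have "(stake_size n v)\<^sup>2 = (\<Sum>k\<in>{1..n}. \<Sum>l\<in>{1..n}. \<bar>v k\<bar> * \<bar>v l\<bar>)"
    by (simp only: stake_size_def power2_eq_square sum_product)
  then have "(\<Sum>k\<in>{1..n}. \<Sum>l\<in>{1..n}. v k * A k l * v l) - q * (stake_size n v)\<^sup>2
      = (\<Sum>k\<in>{1..n}. \<Sum>l\<in>{1..n}. v k * A k l * v l - q * (\<bar>v k\<bar> * \<bar>v l\<bar>))"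
    by (simp only: sum_distrib_left sum_subtractf)
  also have "\<dots> \<le> (\<Sum>k\<in>{1..n}. \<Sum>l\<in>{1..n}. v k * v l * ?E k l)"
  proof (intro sum_mono)
    fix k l assume kl: "k \<in> {1..n}" "l \<in> {1..n}"
    have "\<bar>v k * v l * (?E k l - A k l)\<bar> \<le> \<bar>v k\<bar> * \<bar>v l\<bar> * q"
      unfolding abs_mult using close kl by (intro mult_left_mono) auto
    then show "v k * A k l * v l - q * (\<bar>v k\<bar> * \<bar>v l\<bar>) \<le> v k * v l * ?E k l"
      by (simp add: abs_le_iff algebra_simps)
  qed
  finally show ?thesis using q[of v] E by simp
qed

lemma G_ind_arg_max_nonneg:
  assumes "is_arg_max (G_ind n M Z) (stake_vector n) y"
  shows "0 \<le> G_ind n M Z y"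
proof -
  have "G_ind n M Z (\<lambda>_. 0) = 0"
    by (simp add: G_ind_def dotp_def log_ext_def expect_ext_def)
  moreover have "stake_vector n (\<lambda>_. 0)" by (simp add: stake_vector_def)
  ultimately show ?thesis using assms unfolding is_arg_max_def by (metis not_le)
qed

text \<open>
  The bound \<open>4 \<eta> / q\<close> on the stake size becomes linear in \<open>\<epsilon>\<close>: the drift \<open>\<eta>\<close> is of order \<open>\<epsilon>\<close>, while
  \<open>q\<close> is fixed, half of the coercivity constant of the limiting second-moment matrix.
\<close>
lemma eventually_optimal_stake_size_le:
  fixes M :: "real \<Rightarrow> 'w measure" and Z :: "real \<Rightarrow> 'w \<Rightarrow> nat \<Rightarrow> real"
  assumes prob: "\<forall>\<^sub>F \<epsilon> in at_right 0. prob_space (M \<epsilon>)"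
    and Z: "\<forall>\<^sub>F \<epsilon> in at_right 0. Z \<epsilon> \<in> measurable (M \<epsilon>) (PiM {1..n} (\<lambda>_. borel))"
    and B: "\<forall>\<^sub>F \<epsilon> in at_right 0. AE \<omega> in M \<epsilon>. \<forall>k\<in>{1..n}. \<bar>Z \<epsilon> \<omega> k\<bar> \<le> B" and "0 < B"
    and mean: "\<And>k. k \<in> {1..n} \<Longrightarrow>
      (\<lambda>\<epsilon>. (\<integral>\<omega>. Z \<epsilon> \<omega> k \<partial>M \<epsilon>)) \<in> O[at_right 0](\<lambda>\<epsilon>. \<epsilon>)"
    and second: "\<And>k l. k \<in> {1..n} \<Longrightarrow> l \<in> {1..n} \<Longrightarrow>
      ((\<lambda>\<epsilon>. (\<integral>\<omega>. Z \<epsilon> \<omega> k * Z \<epsilon> \<omega> l \<partial>M \<epsilon>)) \<longlongrightarrow> A k l) (at_right 0)"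
    and pd: "positive_definite_mat n A"
    and max: "\<forall>\<^sub>F \<epsilon> in at_right 0. is_arg_max (G_ind n (M \<epsilon>) (Z \<epsilon>)) (stake_vector n) (y \<epsilon>)"
  shows "\<exists>L\<ge>0. \<forall>\<^sub>F \<epsilon> in at_right 0. stake_size n (y \<epsilon>) \<le> L * \<epsilon>"
proof -
  obtain q' where q': "0 < q'"
    "\<And>v. q' * (stake_size n v)\<^sup>2 \<le> (\<Sum>k\<in>{1..n}. \<Sum>l\<in>{1..n}. v k * A k l * v l)"
    using positive_definite_mat_coercive[OF pd] by blast
  define q where "q = q' / 2"
  have q: "0 < q" "\<And>v. 2 * q * (stake_size n v)\<^sup>2 \<le> (\<Sum>k\<in>{1..n}. \<Sum>l\<in>{1..n}. v k * A k l * v l)"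
    using q' by (simp_all add: q_def)
  have "\<exists>c. \<forall>k\<in>{1..n}. 0 < c k \<and> (\<forall>\<^sub>F \<epsilon> in at_right 0. norm (\<integral>\<omega>. Z \<epsilon> \<omega> k \<partial>M \<epsilon>) \<le> c k * norm \<epsilon>)"
    using mean unfolding bigo_def by (intro bchoice) auto
  then obtain c where c: "\<And>k. k \<in> {1..n} \<Longrightarrow> 0 < c k"
    "\<And>k. k \<in> {1..n} \<Longrightarrow> \<forall>\<^sub>F \<epsilon> in at_right 0. norm (\<integral>\<omega>. Z \<epsilon> \<omega> k \<partial>M \<epsilon>) \<le> c k * norm \<epsilon>" by blast
  define D where "D = (\<Sum>k\<in>{1..n}. c k)"
  have D: "0 \<le> D" unfolding D_def using c(1) by (intro sum_nonneg) (auto intro: less_imp_le)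
  have pos: "\<forall>\<^sub>F \<epsilon> in at_right (0::real). 0 < \<epsilon>" by (rule eventually_at_right_less)
  have "\<forall>\<^sub>F \<epsilon> in at_right 0. \<forall>k\<in>{1..n}. norm (\<integral>\<omega>. Z \<epsilon> \<omega> k \<partial>M \<epsilon>) \<le> c k * norm \<epsilon>"
    using c(2) by (intro eventually_ball_finite) auto
  then have evm: "\<forall>\<^sub>F \<epsilon> in at_right 0. \<forall>k\<in>{1..n}. \<bar>\<integral>\<omega>. Z \<epsilon> \<omega> k \<partial>M \<epsilon>\<bar> \<le> D * \<epsilon>"
    using pos
  proof eventually_elim
    fix \<epsilon> :: real assume *: "\<forall>k\<in>{1..n}. norm (\<integral>\<omega>. Z \<epsilon> \<omega> k \<partial>M \<epsilon>) \<le> c k * norm \<epsilon>" "0 < \<epsilon>"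
    show "\<forall>k\<in>{1..n}. \<bar>\<integral>\<omega>. Z \<epsilon> \<omega> k \<partial>M \<epsilon>\<bar> \<le> D * \<epsilon>"
    proof
      fix k assume k: "k \<in> {1..n}"
      have "c k \<le> D" unfolding D_def using k c(1) by (intro member_le_sum) (auto intro: less_imp_le)
      then have "c k * \<epsilon> \<le> D * \<epsilon>" using *(2) by (intro mult_right_mono) auto
      then show "\<bar>\<integral>\<omega>. Z \<epsilon> \<omega> k \<partial>M \<epsilon>\<bar> \<le> D * \<epsilon>" using *(1)[rule_format, OF k] *(2)
        unfolding real_norm_def by linarith
    qed
  qed
  have evs: "\<forall>\<^sub>F \<epsilon> in at_right 0. \<forall>k\<in>{1..n}. \<forall>l\<in>{1..n}.
      \<bar>(\<integral>\<omega>. Z \<epsilon> \<omega> k * Z \<epsilon> \<omega> l \<partial>M \<epsilon>) - A k l\<bar> \<le> q"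
  proof (intro eventually_ball_finite finite_atLeastAtMost ballI)
    fix k l assume "k \<in> {1..n}" "l \<in> {1..n}"
    from tendstoD[OF second[OF this] q(1)]
    show "\<forall>\<^sub>F \<epsilon> in at_right 0. \<bar>(\<integral>\<omega>. Z \<epsilon> \<omega> k * Z \<epsilon> \<omega> l \<partial>M \<epsilon>) - A k l\<bar> \<le> q"
      by eventually_elim (simp add: dist_real_def)
  qed
  have "((\<lambda>\<epsilon>. 8 * (D * \<epsilon>) * B) \<longlongrightarrow> 8 * (D * 0) * B) (at_right 0)"
    by (intro tendsto_intros)
  then have low: "\<forall>\<^sub>F \<epsilon> in at_right 0. 8 * (D * \<epsilon>) * B < q"
    using q(1) by (intro order_tendstoD(2)[of _ 0]) simp_all
  have "\<forall>\<^sub>F \<epsilon> in at_right 0. stake_size n (y \<epsilon>) \<le> 4 * D / q * \<epsilon>"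
    using prob Z B evm evs low max pos
  proof eventually_elim
    fix \<epsilon> assume "prob_space (M \<epsilon>)"
      and Z: "Z \<epsilon> \<in> measurable (M \<epsilon>) (PiM {1..n} (\<lambda>_. borel))"
      and B: "AE \<omega> in M \<epsilon>. \<forall>k\<in>{1..n}. \<bar>Z \<epsilon> \<omega> k\<bar> \<le> B"
      and m: "\<forall>k\<in>{1..n}. \<bar>\<integral>\<omega>. Z \<epsilon> \<omega> k \<partial>M \<epsilon>\<bar> \<le> D * \<epsilon>"
      and s: "\<forall>k\<in>{1..n}. \<forall>l\<in>{1..n}. \<bar>(\<integral>\<omega>. Z \<epsilon> \<omega> k * Z \<epsilon> \<omega> l \<partial>M \<epsilon>) - A k l\<bar> \<le> q"
      and low: "8 * (D * \<epsilon>) * B < q"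
      and max: "is_arg_max (G_ind n (M \<epsilon>) (Z \<epsilon>)) (stake_vector n) (y \<epsilon>)" and "0 < \<epsilon>"
    then interpret prob_space "M \<epsilon>" by simp
    have "stake_size n (y \<epsilon>) * q \<le> 4 * (D * \<epsilon>)"
      using m by (intro optimal_stake_size_le[OF Z B \<open>0 < B\<close> _ _ second_moment_coercive[OF Z B q(2) s] q(1)
          G_ind_arg_max_nonneg[OF max] low]) (use D \<open>0 < \<epsilon>\<close> in auto)
    then show "stake_size n (y \<epsilon>) \<le> 4 * D / q * \<epsilon>" using q(1) by (simp add: field_simps)
  qed
  moreover have "0 \<le> 4 * D / q" using D q by simp
  ultimately show ?thesis by blast
qed

section \<open>The value gap\<close>

theorem proposition5p1:
  fixes m :: nat and d :: "nat \<Rightarrow> nat"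
    and M :: "real \<Rightarrow> 'w measure"
    and Z :: "real \<Rightarrow> nat \<Rightarrow> 'w \<Rightarrow> nat \<Rightarrow> real"
    and a :: "nat \<Rightarrow> nat \<Rightarrow> real" and C :: "nat \<Rightarrow> nat \<Rightarrow> nat \<Rightarrow> real"
    and B :: real
    and x_ind x_sim :: "real \<Rightarrow> nat \<Rightarrow> nat \<Rightarrow> real"
    and V_par V_sing :: "real \<Rightarrow> ereal"
  assumes blocks: "1 \<le> m"
    and prob: "\<forall>\<^sub>F \<epsilon> in at_right 0. prob_space (M \<epsilon>)"
    and indep: "\<forall>\<^sub>F \<epsilon> in at_right 0.
      prob_space.indep_vars (M \<epsilon>) (\<lambda>j. PiM {1..d j} (\<lambda>_. borel)) (Z \<epsilon>) {1..m}"
    and bounded: "\<forall>\<^sub>F \<epsilon> in at_right 0. \<forall>j\<in>{1..m}. AE \<omega> in M \<epsilon>. \<forall>k\<in>{1..d j}. \<bar>Z \<epsilon> j \<omega> k\<bar> \<le> B"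
    and mean: "\<And>j k. j \<in> {1..m} \<Longrightarrow> k \<in> {1..d j} \<Longrightarrow>
      (\<lambda>\<epsilon>. (\<integral>\<omega>. Z \<epsilon> j \<omega> k \<partial>M \<epsilon>) - a j k * \<epsilon>) \<in> O[at_right 0](\<lambda>\<epsilon>. \<epsilon> ^ 2)"
    and second_moment: "\<And>j k l. j \<in> {1..m} \<Longrightarrow> k \<in> {1..d j} \<Longrightarrow> l \<in> {1..d j} \<Longrightarrow>
      (\<lambda>\<epsilon>. (\<integral>\<omega>. Z \<epsilon> j \<omega> k * Z \<epsilon> j \<omega> l \<partial>M \<epsilon>) - C j k l) \<in> O[at_right 0](\<lambda>\<epsilon>. \<epsilon>)"
    and pos_def: "\<And>j. j \<in> {1..m} \<Longrightarrow> positive_definite_mat (d j) (C j)"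
    and max_ind: "\<forall>\<^sub>F \<epsilon> in at_right 0. \<forall>j\<in>{1..m}.
      is_arg_max (G_ind (d j) (M \<epsilon>) (Z \<epsilon> j)) (stake_vector (d j)) (x_ind \<epsilon> j)"
    and max_sim: "\<forall>\<^sub>F \<epsilon> in at_right 0.
      is_arg_max (G_sing m d (M \<epsilon>) (Z \<epsilon>)) (stake_profile m d) (x_sim \<epsilon>)"
    and active_support: "\<forall>\<^sub>F \<epsilon> in at_right 0.
      \<forall>j\<in>{1..m}. \<forall>k\<in>{1..d j}. 0 < x_ind \<epsilon> j k \<and> 0 < x_sim \<epsilon> j k"
    and V_sing: "\<And>\<epsilon>. V_sing \<epsilon> = G_sing m d (M \<epsilon>) (Z \<epsilon>) (x_sim \<epsilon>)"
    and V_par: "\<And>\<epsilon>. V_par \<epsilon> = (\<Sum>j\<in>{1..m}. G_ind (d j) (M \<epsilon>) (Z \<epsilon> j) (x_ind \<epsilon> j))"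
  shows "(\<forall>\<^sub>F \<epsilon> in at_right 0.
            \<bar>V_par \<epsilon>\<bar> \<noteq> \<infinity> \<and> \<bar>V_sing \<epsilon>\<bar> \<noteq> \<infinity> \<and> 0 \<le> V_par \<epsilon> - V_sing \<epsilon>) \<and>
         (\<lambda>\<epsilon>. real_of_ereal (V_par \<epsilon> - V_sing \<epsilon>)) \<in> O[at_right 0](\<lambda>\<epsilon>. \<epsilon> ^ 4)"
proof -
  \<comment> \<open>The single-block estimates divide by the bound on the outcomes, so it is made positive.\<close>
  define B' where "B' = max B 1"
  have B': "0 < B'" "B \<le> B'" by (simp_all add: B'_def)
  have bounded': "\<forall>\<^sub>F \<epsilon> in at_right 0. \<forall>j\<in>{1..m}. AE \<omega> in M \<epsilon>. \<forall>k\<in>{1..d j}. \<bar>Z \<epsilon> j \<omega> k\<bar> \<le> B'"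
    using bounded
  proof eventually_elim
    fix \<epsilon> assume *: "\<forall>j\<in>{1..m}. AE \<omega> in M \<epsilon>. \<forall>k\<in>{1..d j}. \<bar>Z \<epsilon> j \<omega> k\<bar> \<le> B"
    show "\<forall>j\<in>{1..m}. AE \<omega> in M \<epsilon>. \<forall>k\<in>{1..d j}. \<bar>Z \<epsilon> j \<omega> k\<bar> \<le> B'"
    proof
      fix j assume "j \<in> {1..m}"
      from *[rule_format, OF this]
      show "AE \<omega> in M \<epsilon>. \<forall>k\<in>{1..d j}. \<bar>Z \<epsilon> j \<omega> k\<bar> \<le> B'"
        by eventually_elim (use B'(2) in force)
    qed
  qed
  have "\<exists>L\<ge>0. \<forall>\<^sub>F \<epsilon> in at_right 0. stake_size (d j) (x_ind \<epsilon> j) \<le> L * \<epsilon>" if j: "j \<in> {1..m}" for j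
  proof (rule eventually_optimal_stake_size_le[OF prob _ _ B'(1) _ _ pos_def[OF j]])
    show "\<forall>\<^sub>F \<epsilon> in at_right 0. Z \<epsilon> j \<in> measurable (M \<epsilon>) (PiM {1..d j} (\<lambda>_. borel))"
      using prob indep by eventually_elim (use j in \<open>simp add: prob_space.indep_vars_def\<close>)
    show "\<forall>\<^sub>F \<epsilon> in at_right 0. AE \<omega> in M \<epsilon>. \<forall>k\<in>{1..d j}. \<bar>Z \<epsilon> j \<omega> k\<bar> \<le> B'"
      using bounded' by eventually_elim (use j in blast)
    show "\<forall>\<^sub>F \<epsilon> in at_right 0.
        is_arg_max (G_ind (d j) (M \<epsilon>) (Z \<epsilon> j)) (stake_vector (d j)) (x_ind \<epsilon> j)"
      using max_ind by eventually_elim (use j in blast)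
    fix k assume k: "k \<in> {1..d j}"
    have "(\<lambda>\<epsilon>::real. \<epsilon> ^ 2) \<in> O[at_right 0](\<lambda>\<epsilon>. \<epsilon>)"
      by real_asymp
    from landau_o.big_trans[OF mean[OF j k] this]
    have "(\<lambda>\<epsilon>. ((\<integral>\<omega>. Z \<epsilon> j \<omega> k \<partial>M \<epsilon>) - a j k * \<epsilon>) + a j k * \<epsilon>) \<in> O[at_right 0](\<lambda>\<epsilon>. \<epsilon>)"
      by (rule sum_in_bigo) simp
    then show "(\<lambda>\<epsilon>. \<integral>\<omega>. Z \<epsilon> j \<omega> k \<partial>M \<epsilon>) \<in> O[at_right 0](\<lambda>\<epsilon>. \<epsilon>)" by simp
    fix l assume l: "l \<in> {1..d j}"
    have "(\<lambda>\<epsilon>::real. \<epsilon>) \<in> o[at_right 0](\<lambda>_. 1)" by real_asymp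
    from landau_o.big_small_trans[OF second_moment[OF j k l] this]
    have "((\<lambda>\<epsilon>. (\<integral>\<omega>. Z \<epsilon> j \<omega> k * Z \<epsilon> j \<omega> l \<partial>M \<epsilon>) - C j k l) \<longlongrightarrow> 0) (at_right 0)"
      by (auto dest: smalloD_tendsto)
    then show "((\<lambda>\<epsilon>. \<integral>\<omega>. Z \<epsilon> j \<omega> k * Z \<epsilon> j \<omega> l \<partial>M \<epsilon>) \<longlongrightarrow> C j k l) (at_right 0)"
      by (simp add: LIM_zero_iff)
  qed
  then obtain L where L: "\<And>j. j \<in> {1..m} \<Longrightarrow> 0 \<le> L j"
    "\<And>j. j \<in> {1..m} \<Longrightarrow> \<forall>\<^sub>F \<epsilon> in at_right 0. stake_size (d j) (x_ind \<epsilon> j) \<le> L j * \<epsilon>" by metis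
  \<comment> \<open>\<open>c \<epsilon>\<close> bounds every single-block return and is the \<open>\<delta>\<close> of the fixed-parameter bounds.\<close>
  define c where "c = (\<Sum>j\<in>{1..m}. L j) * B'"
  have c: "0 \<le> c" unfolding c_def using L(1) B'(1) by (auto intro!: mult_nonneg_nonneg sum_nonneg)
  have pos: "\<forall>\<^sub>F \<epsilon> in at_right (0::real). 0 < \<epsilon>" by (rule eventually_at_right_less)
  have "\<forall>\<^sub>F \<epsilon> in at_right 0. \<forall>j\<in>{1..m}. stake_size (d j) (x_ind \<epsilon> j) \<le> L j * \<epsilon>"
    using L(2) by (intro eventually_ball_finite) auto
  then have size: "\<forall>\<^sub>F \<epsilon> in at_right 0. \<forall>j\<in>{1..m}. stake_size (d j) (x_ind \<epsilon> j) * B' \<le> c * \<epsilon>"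
    using pos
  proof eventually_elim
    fix \<epsilon> :: real assume *: "\<forall>j\<in>{1..m}. stake_size (d j) (x_ind \<epsilon> j) \<le> L j * \<epsilon>" "0 < \<epsilon>"
    show "\<forall>j\<in>{1..m}. stake_size (d j) (x_ind \<epsilon> j) * B' \<le> c * \<epsilon>"
    proof
      fix j assume j: "j \<in> {1..m}"
      have "L j \<le> (\<Sum>j\<in>{1..m}. L j)" using j L(1) by (intro member_le_sum) auto
      then have "L j * \<epsilon> \<le> (\<Sum>j\<in>{1..m}. L j) * \<epsilon>" using *(2) by simp
      with *(1) j have "stake_size (d j) (x_ind \<epsilon> j) \<le> (\<Sum>j\<in>{1..m}. L j) * \<epsilon>" by fastforce
      then have "stake_size (d j) (x_ind \<epsilon> j) * B' \<le> (\<Sum>j\<in>{1..m}. L j) * \<epsilon> * B'"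
        using B'(1) by simp
      then show "stake_size (d j) (x_ind \<epsilon> j) * B' \<le> c * \<epsilon>" by (simp add: c_def mult_ac)
    qed
  qed
  have "((\<lambda>\<epsilon>. c * \<epsilon>) \<longlongrightarrow> c * 0) (at_right 0)" by (intro tendsto_intros)
  then have low1: "\<forall>\<^sub>F \<epsilon> in at_right 0. c * \<epsilon> < 1/4"
    by (intro order_tendstoD(2)[of _ 0]) simp_all
  have "((\<lambda>\<epsilon>. 8 ^ m * (c * \<epsilon>)\<^sup>2) \<longlongrightarrow> 8 ^ m * (c * 0)\<^sup>2) (at_right 0)" by (intro tendsto_intros)
  then have low2: "\<forall>\<^sub>F \<epsilon> in at_right 0. 8 ^ m * (c * \<epsilon>)\<^sup>2 < 1/2"
    by (intro order_tendstoD(2)[of _ 0]) simp_all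
  have main: "\<forall>\<^sub>F \<epsilon> in at_right 0. \<exists>p s. V_par \<epsilon> = ereal p \<and> V_sing \<epsilon> = ereal s \<and>
      s \<le> p \<and> p - s \<le> 2 * 64 ^ m * (c * \<epsilon>) ^ 4"
    using prob indep bounded' size low1 low2 max_ind max_sim active_support pos
  proof eventually_elim
    case (elim \<epsilon>)
    interpret prob_space "M \<epsilon>" by (rule elim(1))
    show ?case
      unfolding V_par V_sing
      using elim c by (intro parlay_value_sandwich[OF elim(2,3) B'(1) elim(4) _ _ _ elim(7) _ elim(8)]) auto
  qed
  have "\<forall>\<^sub>F \<epsilon> in at_right 0. \<bar>V_par \<epsilon>\<bar> \<noteq> \<infinity> \<and> \<bar>V_sing \<epsilon>\<bar> \<noteq> \<infinity> \<and> 0 \<le> V_par \<epsilon> - V_sing \<epsilon>"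
    using main by eventually_elim auto
  moreover have "\<forall>\<^sub>F \<epsilon> in at_right 0.
      norm (real_of_ereal (V_par \<epsilon> - V_sing \<epsilon>)) \<le> (2 * 64 ^ m * c ^ 4) * norm (\<epsilon> ^ 4)"
    using main by eventually_elim (auto simp: power_mult_distrib mult_ac)
  then have "(\<lambda>\<epsilon>. real_of_ereal (V_par \<epsilon> - V_sing \<epsilon>)) \<in> O[at_right 0](\<lambda>\<epsilon>. \<epsilon> ^ 4)"
    by (rule bigoI)
  ultimately show ?thesis by blast
qed

end
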